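(* Let $G$ be a 2-connected plane graph, $G^\nabla$ its auxiliary graph, and $C$ a chordless Jordan separating cycle of $G^\nabla$. If no large face of $G$ crosses $C$, then $V(C)\cap V(G)$ is a minimal cut of $G$.
   Context: In a 2-connected plane graph every face is bounded by a cycle; a large face is a face whose bounding cycle has length at least 4 (faces are identified with their bounding cycles). The auxiliary graph $G^\nabla$ is obtained from $G$ by adding, for each large face $W$, a new vertex $w^\nabla$ placed inside the face $W$ and joined to every vertex of $W$; it is a plane triangulation. For a cycle $C$ of a plane graph, $\mathrm{Int}(C)$ ($\mathrm{Ext}(C)$) is the subgraph of vertices and edges lying strictly inside (outside) $C$; $C$ is Jordan separating if both $\mathrm{Int}(C)$ and $\mathrm{Ext}(C)$ contain at least one vertex. For a large face $W$ of $G$ and a chordless cycle $C$ of $G^\nabla$: $W$ covers $C$ if there exist vertices $x,y$ of $W$ such that $x,w^\nabla,y$ is a path in $C$ and $V(C)\cap V(W)\subseteq\{x,y\}$; $W$ crosses $C$ if $W$ does not cover $C$ and there exist two vertices of $V(W)\cap V(C)$ that are not adjacent in $W$. A cut of a connected graph $G=(V,E)$ is a set $S\subset V$ with $G-S$ disconnected; it is minimal if $G-T$ is connected for every proper subset $T\subset S$. *)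

theory Defs
  imports "HOL-Analysis.Analysis"
begin

section \<open>Simple graphs\<close>

record 'a ugraph =
  verts :: "'a set"
  edges :: "'a set set"

definition simple_graph :: "('a, 'm) ugraph_scheme \<Rightarrow> bool" where
  "simple_graph G \<longleftrightarrow> finite (verts G) \<and>
     (\<forall>e\<in>edges G. \<exists>u\<in>verts G. \<exists>v\<in>verts G. u \<noteq> v \<and> e = {u, v})"

definition subgraph_of :: "('a, 'm) ugraph_scheme \<Rightarrow> ('a, 'n) ugraph_scheme \<Rightarrow> bool" where
  "subgraph_of K G \<longleftrightarrow> verts K \<subseteq> verts G \<and> edges K \<subseteq> edges G"

definition delete_verts :: "('a, 'm) ugraph_scheme \<Rightarrow> 'a set \<Rightarrow> 'a ugraph" where
  "delete_verts G S = \<lparr> verts = verts G - S, edges = {e \<in> edges G. e \<inter> S = {}} \<rparr>"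

text \<open>The empty graph counts as connected, so a disconnected graph is one with two vertices
  that no path joins.\<close>

definition connected_graph :: "('a, 'm) ugraph_scheme \<Rightarrow> bool" where
  "connected_graph G \<longleftrightarrow>
     (\<forall>u\<in>verts G. \<forall>v\<in>verts G. (u, v) \<in> {(a, b). {a, b} \<in> edges G}\<^sup>*)"

definition two_connected :: "('a, 'm) ugraph_scheme \<Rightarrow> bool" where
  "two_connected G \<longleftrightarrow> 3 \<le> card (verts G) \<and> connected_graph G \<and>
     (\<forall>v\<in>verts G. connected_graph (delete_verts G {v}))"

definition is_cycle :: "('a, 'm) ugraph_scheme \<Rightarrow> bool" where
  "is_cycle C \<longleftrightarrow> (\<exists>vs. distinct vs \<and> 3 \<le> length vs \<and> verts C = set vs \<and>
     edges C = {{vs ! i, vs ! (Suc i mod length vs)} | i. i < length vs})"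

definition cycle_of :: "('a, 'm) ugraph_scheme \<Rightarrow> ('a, 'n) ugraph_scheme \<Rightarrow> bool" where
  "cycle_of C G \<longleftrightarrow> is_cycle C \<and> subgraph_of C G"

definition chordless :: "('a, 'm) ugraph_scheme \<Rightarrow> ('a, 'n) ugraph_scheme \<Rightarrow> bool" where
  "chordless C G \<longleftrightarrow> (\<forall>e\<in>edges G. e \<subseteq> verts C \<longrightarrow> e \<in> edges C)"

definition is_cut :: "('a, 'm) ugraph_scheme \<Rightarrow> 'a set \<Rightarrow> bool" where
  "is_cut G S \<longleftrightarrow> S \<subseteq> verts G \<and> \<not> connected_graph (delete_verts G S)"

definition minimal_cut :: "('a, 'm) ugraph_scheme \<Rightarrow> 'a set \<Rightarrow> bool" where
  "minimal_cut G S \<longleftrightarrow> is_cut G S \<and> (\<forall>T. T \<subset> S \<longrightarrow> connected_graph (delete_verts G T))"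


section \<open>Plane graphs\<close>

text \<open>Vertices are points of the plane, and every edge \<open>{u, v}\<close> is drawn as an arc, recorded
  as a point set, with end points \<open>u\<close> and \<open>v\<close>.\<close>

record plane_drawing = "complex ugraph" +
  arc_of :: "complex set \<Rightarrow> complex set"

definition plane_graph :: "plane_drawing \<Rightarrow> bool" where
  "plane_graph G \<longleftrightarrow> simple_graph G \<and>
     (\<forall>e\<in>edges G. \<exists>g. arc g \<and> path_image g = arc_of G e \<and> {pathstart g, pathfinish g} = e) \<and>
     (\<forall>e\<in>edges G. (arc_of G e - e) \<inter> verts G = {}) \<and>
     (\<forall>e\<in>edges G. \<forall>f\<in>edges G. e \<noteq> f \<longrightarrow> (arc_of G e - e) \<inter> arc_of G f = {})"

text \<open>The point set of a subgraph \<open>K\<close> of the plane graph \<open>G\<close>.\<close>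

definition points_of :: "plane_drawing \<Rightarrow> (complex, 'm) ugraph_scheme \<Rightarrow> complex set" where
  "points_of G K = verts K \<union> (\<Union>e\<in>edges K. arc_of G e)"

definition faces :: "plane_drawing \<Rightarrow> complex set set" where
  "faces G = components (- points_of G G)"

text \<open>A face is represented by its region rather than by its bounding cycle, because if \<open>G\<close> is
  itself a cycle then its two faces have the same bounding cycle. The bounding cycle is
  recovered as the subgraph formed by the vertices and edges on the frontier of the region.\<close>

definition boundary :: "plane_drawing \<Rightarrow> complex set \<Rightarrow> complex ugraph" where
  "boundary G F = \<lparr> verts = {v \<in> verts G. v \<in> frontier F},
                    edges = {e \<in> edges G. arc_of G e \<subseteq> frontier F} \<rparr>"

definition large_faces :: "plane_drawing \<Rightarrow> complex set set" where
  "large_faces G = {F \<in> faces G. is_cycle (boundary G F) \<and> 4 \<le> card (edges (boundary G F))}"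

definition Int_graph :: "plane_drawing \<Rightarrow> (complex, 'm) ugraph_scheme \<Rightarrow> complex ugraph" where
  "Int_graph G C = \<lparr> verts = {v \<in> verts G. v \<in> inside (points_of G C)},
                     edges = {e \<in> edges G. arc_of G e \<subseteq> inside (points_of G C)} \<rparr>"

definition Ext_graph :: "plane_drawing \<Rightarrow> (complex, 'm) ugraph_scheme \<Rightarrow> complex ugraph" where
  "Ext_graph G C = \<lparr> verts = {v \<in> verts G. v \<in> outside (points_of G C)},
                     edges = {e \<in> edges G. arc_of G e \<subseteq> outside (points_of G C)} \<rparr>"

definition Jordan_separating :: "plane_drawing \<Rightarrow> (complex, 'm) ugraph_scheme \<Rightarrow> bool" where
  "Jordan_separating G C \<longleftrightarrow> verts (Int_graph G C) \<noteq> {} \<and> verts (Ext_graph G C) \<noteq> {}"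


section \<open>The auxiliary graph\<close>

text \<open>The placement of the new vertices and the drawing of the new edges are not unique, so the
  auxiliary graph is a relation: \<open>H\<close> is an auxiliary graph of \<open>G\<close> in which the new vertex of
  the large face \<open>F\<close> is \<open>nabla F\<close>. Planarity of \<open>H\<close> forces each new edge to run inside the
  corresponding face, apart from its end on the boundary.\<close>

definition auxiliary_graph ::
    "plane_drawing \<Rightarrow> (complex set \<Rightarrow> complex) \<Rightarrow> plane_drawing \<Rightarrow> bool" where
  "auxiliary_graph G nabla H \<longleftrightarrow> plane_graph H \<and>
     (\<forall>F\<in>large_faces G. nabla F \<in> F) \<and>
     verts H = verts G \<union> nabla ` large_faces G \<and>
     edges H = edges G \<union>
       {{nabla F, v} | F v. F \<in> large_faces G \<and> v \<in> verts (boundary G F)} \<and>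
     (\<forall>e\<in>edges G. arc_of H e = arc_of G e)"

definition covers :: "plane_drawing \<Rightarrow> (complex set \<Rightarrow> complex) \<Rightarrow> complex set \<Rightarrow>
    (complex, 'm) ugraph_scheme \<Rightarrow> bool" where
  "covers G nabla F C \<longleftrightarrow>
     (\<exists>x\<in>verts (boundary G F). \<exists>y\<in>verts (boundary G F). x \<noteq> y \<and>
        {x, nabla F} \<in> edges C \<and> {nabla F, y} \<in> edges C \<and>
        verts C \<inter> verts (boundary G F) \<subseteq> {x, y})"

definition crosses :: "plane_drawing \<Rightarrow> (complex set \<Rightarrow> complex) \<Rightarrow> complex set \<Rightarrow>
    (complex, 'm) ugraph_scheme \<Rightarrow> bool" where
  "crosses G nabla F C \<longleftrightarrow> \<not> covers G nabla F C \<and>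
     (\<exists>x\<in>verts (boundary G F) \<inter> verts C. \<exists>y\<in>verts (boundary G F) \<inter> verts C.
        x \<noteq> y \<and> {x, y} \<notin> edges (boundary G F))"

end

theory Submission
  imports Defs
begin

text \<open>Let \<open>A\<close> be one of the two sides of \<open>C\<close> and let \<open>K\<close> be the plane graph \<open>G \<union> C\<close>, which is again
  2-connected, so that each of its faces is bounded by a cycle (by an ear decomposition; an ear
  splits a face as in a theta graph). The boundary cycle of a face \<open>\<phi> \<subseteq> A\<close> of \<open>K\<close> meets \<open>C\<close> in
  an edge, a vertex or nothing if \<open>\<phi>\<close> is a face of \<open>G\<close>, because \<open>C\<close> is chordless and not crossed,
  and in the path \<open>x, w, y\<close> if \<open>\<phi>\<close> is a part of the large face with new vertex \<open>w\<close> on \<open>C\<close>. In each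
  case what remains of the boundary is a nonempty path of \<open>G - V(C)\<close> adjacent to all vertices
  of \<open>G\<close> on \<open>C\<close> that lie on the boundary. The closures of these faces cover \<open>A\<close>, so
  connectedness of \<open>A\<close> makes the vertices of \<open>G\<close> in \<open>A\<close> a connected part of \<open>G - V(C)\<close>, and
  every vertex of \<open>V(C) \<inter> V(G)\<close> has a neighbour in it.\<close>


section \<open>Paths and cycles as vertex lists\<close>

text \<open>Working with \<open>K\<close> instead of the triangulation \<open>H\<close> keeps the
  argument inside \<open>G\<close>: a face boundary of \<open>H\<close> may pass through new
  vertices off \<open>C\<close>, whereas all new vertices of \<open>K\<close> lie on
  \<open>C\<close>, so any part of a face boundary of \<open>K\<close> that avoids \<open>C\<close>
  is a path of \<open>G\<close>. The price is that the faces of \<open>K\<close> have no fixed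
  shape, so that their boundaries must first be shown to be cycles. The hypotheses on
  \<open>C\<close> act on different faces. A large face whose new vertex is off \<open>C\<close> is
  controlled by the absence of crossings; one whose new vertex is on \<open>C\<close> is controlled
  by chordlessness, because each of its boundary vertices is joined to the new vertex in
  \<open>H\<close>. Chordlessness also gives every edge of \<open>K\<close> outside \<open>C\<close>
  an end off \<open>C\<close>. Connectedness of a side is exploited through closed covers, in place
  of chains of adjacent faces; this requires finitely many faces, which again follows from their
  boundaries being cycles.\<close>

fun path_edges :: "'a list \<Rightarrow> 'a set set" where
  "path_edges (x # y # zs) = insert {x, y} (path_edges (y # zs))"
| "path_edges _ = {}"

lemma path_edges_append: "path_edges (xs @ x # ys) = path_edges (xs @ [x]) \<union> path_edges (x # ys)"
proof (induction xs rule: path_edges.induct)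
  case (1 a b zs)
  then show ?case by auto
qed simp_all

lemma path_edges_rev: "path_edges (rev xs) = path_edges xs"
proof (induction xs rule: path_edges.induct)
  case (1 x y zs)
  have "path_edges (rev (x # y # zs)) = path_edges (rev zs @ [y]) \<union> path_edges [y, x]"
    using path_edges_append [of "rev zs" y "[x]"] by simp
  with 1 show ?case by (auto simp: insert_commute)
qed auto

lemma path_edges_conv_nth: "path_edges xs = {{xs ! i, xs ! Suc i} | i. Suc i < length xs}"
proof (induction xs rule: path_edges.induct)
  case (1 x y zs)
  have "{{(x # y # zs) ! i, (x # y # zs) ! Suc i} | i. Suc i < length (x # y # zs)}
      = insert {x, y} {{(y # zs) ! i, (y # zs) ! Suc i} | i. Suc i < length (y # zs)}" (is "?L = ?R")
  proof
    show "?L \<subseteq> ?R"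
    proof
      fix e assume "e \<in> ?L"
      then obtain i where "e = {(x # y # zs) ! i, (x # y # zs) ! Suc i}" "Suc i < length (x # y # zs)"
        by blast
      then show "e \<in> ?R" by (cases i) auto
    qed
    show "?R \<subseteq> ?L"
    proof
      fix e assume "e \<in> ?R"
      then consider "e = {x, y}"
        | i where "e = {(y # zs) ! i, (y # zs) ! Suc i}" "Suc i < length (y # zs)"
        by blast
      then show "e \<in> ?L"
      proof cases
        case 1
        then show ?thesis by (auto intro!: exI [of _ 0])
      next
        case 2
        then show ?thesis by (auto intro!: exI [of _ "Suc i"])
      qed
    qed
  qed
  with 1 show ?case by simp
qed auto

lemma path_edges_subset: "e \<in> path_edges xs \<Longrightarrow> e \<subseteq> set xs"
  by (induction xs rule: path_edges.induct) auto

lemma path_edges_cover: "2 \<le> length xs \<Longrightarrow> v \<in> set xs \<Longrightarrow> \<exists>e\<in>path_edges xs. v \<in> e"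
proof (induction xs rule: path_edges.induct)
  case (1 x y zs)
  then show ?case by (cases zs) auto
qed auto

lemma cycle_edges_rotate:
  assumes "xs \<noteq> []" "ys \<noteq> []"
  shows "path_edges (xs @ ys @ [hd xs]) = path_edges (ys @ xs @ [hd ys])"
proof -
  obtain x xs' y ys' where "xs = x # xs'" "ys = y # ys'"
    using assms by (meson neq_Nil_conv)
  then show ?thesis
    using path_edges_append [of "x # xs'" y "ys' @ [x]"] path_edges_append [of "y # ys'" x "xs' @ [y]"]
    by auto
qed

lemma cycle_edges_conv_nth:
  assumes "vs \<noteq> []"
  shows "path_edges (vs @ [hd vs]) = {{vs ! i, vs ! (Suc i mod length vs)} | i. i < length vs}"
proof -
  have "(vs @ [hd vs]) ! Suc i = vs ! (Suc i mod length vs)" if "i < length vs" for i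
  proof (cases "Suc i = length vs")
    case True
    then show ?thesis using assms by (simp add: nth_append hd_conv_nth)
  next
    case False
    then show ?thesis using that by (simp add: nth_append)
  qed
  moreover have "(vs @ [hd vs]) ! i = vs ! i" if "i < length vs" for i
    using that by (simp add: nth_append)
  ultimately have "{(vs @ [hd vs]) ! i, (vs @ [hd vs]) ! Suc i}
      = {vs ! i, vs ! (Suc i mod length vs)}" if "i < length vs" for i
    using that by presburger
  then show ?thesis
    unfolding path_edges_conv_nth by (intro Collect_cong ex_cong) auto
qed

text \<open>Repeating the head at the end of the list replaces the modular index by concatenation,
  so that cycles can be cut and rotated with the rules for \<open>path_edges\<close>.\<close>

lemma is_cycle_iff:
  "is_cycle C \<longleftrightarrow> (\<exists>vs. distinct vs \<and> 3 \<le> length vs \<and> verts C = set vs \<and>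
     edges C = path_edges (vs @ [hd vs]))"
proof -
  have "path_edges (vs @ [hd vs]) = {{vs ! i, vs ! (Suc i mod length vs)} | i. i < length vs}"
    if "3 \<le> length vs" for vs :: "'a list"
    using that by (intro cycle_edges_conv_nth) auto
  then show ?thesis
    unfolding is_cycle_def by (intro ex_cong) auto
qed

lemma is_cycle_at:
  assumes "is_cycle C" "v \<in> verts C"
  obtains ws where "distinct (v # ws)" "2 \<le> length ws" "verts C = set (v # ws)"
    "edges C = path_edges (v # ws @ [v])"
proof -
  obtain vs where vs: "distinct vs" "3 \<le> length vs" "verts C = set vs"
      "edges C = path_edges (vs @ [hd vs])"
    using assms(1) unfolding is_cycle_iff by blast
  then obtain xs ys where split: "vs = xs @ v # ys"
    using assms(2) by (metis split_list)
  have "edges C = path_edges (v # ys @ xs @ [v])"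
  proof (cases "xs = []")
    case True
    with vs split show ?thesis by simp
  next
    case False
    with vs split cycle_edges_rotate [of xs "v # ys"] show ?thesis by simp
  qed
  moreover have "distinct (v # ys @ xs)" "2 \<le> length (ys @ xs)" "verts C = set (v # ys @ xs)"
    using vs split by auto
  ultimately show ?thesis using that [of "ys @ xs"] by simp
qed

lemma path_edges_end:
  assumes "distinct (v # ws)" "ws \<noteq> []"
  shows "{v, u} \<in> path_edges (v # ws @ [v]) \<longleftrightarrow> u = hd ws \<or> u = last ws"
proof -
  obtain w ws' where ws: "ws = w # ws'" using assms(2) by (cases ws) auto
  have "path_edges (ws @ [v]) = path_edges ws \<union> {{last ws, v}}"
    using assms(2) path_edges_append [of "butlast ws" "last ws" "[v]"]
    by (metis append.assoc append_Cons append_butlast_last_id append_self_conv2 path_edges.simps(1,3))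
  moreover have "v \<notin> set ws" using assms by auto
  moreover have "{v, u} \<notin> path_edges ws"
    using path_edges_subset [of "{v, u}" ws] \<open>v \<notin> set ws\<close> by auto
  moreover have "path_edges (v # ws @ [v]) = insert {v, hd ws} (path_edges (ws @ [v]))"
    using ws by simp
  ultimately have *: "path_edges (v # ws @ [v]) = {{v, hd ws}, {v, last ws}} \<union> path_edges ws"
    by (simp add: insert_commute)
  show ?thesis
    unfolding * using \<open>{v, u} \<notin> path_edges ws\<close> by (auto simp: doubleton_eq_iff)
qed

lemma is_cycle_edge_subset:
  assumes "is_cycle C" "e \<in> edges C" shows "e \<subseteq> verts C"
proof -
  obtain vs where vs: "3 \<le> length vs" "verts C = set vs" "edges C = path_edges (vs @ [hd vs])"
    using assms(1) unfolding is_cycle_iff by blast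
  then have "hd vs \<in> set vs" by (intro hd_in_set) auto
  with vs assms(2) path_edges_subset show ?thesis by fastforce
qed

lemma is_cycle_covered:
  assumes "is_cycle C" "v \<in> verts C" shows "\<exists>e\<in>edges C. v \<in> e"
proof -
  obtain ws where "2 \<le> length ws" "edges C = path_edges (v # ws @ [v])"
    using is_cycle_at [OF assms] by metis
  then show ?thesis by (cases ws) auto
qed

lemma is_cycle_split:
  assumes "is_cycle C" "a \<in> verts C" "c \<in> verts C" "a \<noteq> c"
  obtains xs ys where "distinct (a # xs @ c # ys)" "verts C = set (a # xs @ c # ys)"
    "edges C = path_edges (a # xs @ [c]) \<union> path_edges (c # ys @ [a])"
    "xs \<noteq> [] \<or> ys \<noteq> []"
proof -
  obtain ws where ws: "distinct (a # ws)" "2 \<le> length ws" "verts C = set (a # ws)"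
    "edges C = path_edges (a # ws @ [a])"
    using is_cycle_at [OF assms(1,2)] by metis
  then obtain xs ys where split: "ws = xs @ c # ys"
    using assms(3,4) by (metis set_ConsD split_list)
  have "edges C = path_edges (a # xs @ [c]) \<union> path_edges (c # ys @ [a])"
    using ws split path_edges_append [of "a # xs" c "ys @ [a]"] by simp
  moreover have "xs \<noteq> [] \<or> ys \<noteq> []" using ws(2) split by auto
  moreover have "distinct (a # xs @ c # ys)" "verts C = set (a # xs @ c # ys)"
    using ws(1,3) unfolding split .
  ultimately show ?thesis using that by blast
qed

lemma is_cycle_two_paths:
  assumes "distinct (a # xs @ c # ys)" "xs \<noteq> [] \<or> ys \<noteq> []"
  shows "is_cycle \<lparr>verts = set (a # xs @ c # ys),
    edges = path_edges (a # xs @ [c]) \<union> path_edges (c # ys @ [a])\<rparr>"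
proof -
  let ?vs = "a # xs @ c # ys"
  have "path_edges (?vs @ [hd ?vs]) = path_edges (a # xs @ [c]) \<union> path_edges (c # ys @ [a])"
    using path_edges_append [of "a # xs" c "ys @ [a]"] by simp
  moreover have "3 \<le> length ?vs"
    using assms(2) by (cases xs; cases ys) simp_all
  ultimately show ?thesis
    unfolding is_cycle_iff ugraph.select_convs using assms(1) by metis
qed

text \<open>Two different positions carrying the same edge would be cyclic successors of each other,
  which is impossible from length three on.\<close>

lemma card_cycle_edges:
  assumes "distinct vs" "3 \<le> length vs"
  shows "card (path_edges (vs @ [hd vs])) = length vs"
proof -
  have "inj_on (\<lambda>i. {vs ! i, vs ! (Suc i mod length vs)}) {..<length vs}"
  proof (rule inj_onI)
    fix i j assume ij: "i \<in> {..<length vs}" "j \<in> {..<length vs}"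
      and eq: "{vs ! i, vs ! (Suc i mod length vs)} = {vs ! j, vs ! (Suc j mod length vs)}"
    have l: "Suc i mod length vs < length vs" "Suc j mod length vs < length vs"
      using ij by (auto intro: mod_less_divisor)
    show "i = j"
    proof (rule ccontr)
      assume "i \<noteq> j"
      then have "vs ! i \<noteq> vs ! j"
        using ij assms(1) by (simp add: nth_eq_iff_index_eq)
      with eq have "vs ! i = vs ! (Suc j mod length vs)" "vs ! j = vs ! (Suc i mod length vs)"
        unfolding doubleton_eq_iff by simp_all
      then have "i = Suc j mod length vs" "j = Suc i mod length vs"
        using nth_eq_iff_index_eq [OF assms(1)] ij l by (metis lessThan_iff)+
      moreover have "Suc k mod length vs = (if Suc k = length vs then 0 else Suc k)"
        if "k < length vs" for k
        using that by simp
      ultimately have ij': "i = (if Suc j = length vs then 0 else Suc j)"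
          "j = (if Suc i = length vs then 0 else Suc i)"
        using ij by (metis lessThan_iff)+
      have "i = Suc j \<or> Suc j = length vs \<and> i = 0" using ij'(1) by metis
      moreover have "j = Suc i \<or> Suc i = length vs \<and> j = 0" using ij'(2) by metis
      ultimately show False using assms(2) by linarith
    qed
  qed
  moreover have "path_edges (vs @ [hd vs])
      = (\<lambda>i. {vs ! i, vs ! (Suc i mod length vs)}) ` {..<length vs}"
    using assms(2) by (subst cycle_edges_conv_nth) auto
  ultimately show ?thesis by (simp add: card_image)
qed

lemma path_edges_doubleton:
  assumes "distinct vs" "e \<in> path_edges vs"
  obtains u v where "u \<noteq> v" "e = {u, v}"
  using assms by (induction vs rule: path_edges.induct) auto

lemma path_edges_closing:
  assumes "distinct (a # xs @ [c])" "{a, c} \<in> path_edges (a # xs @ [c])"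
  shows "xs = []"
proof (cases xs)
  case (Cons x xs')
  then have "{a, c} \<in> path_edges (x # xs' @ [c])"
    using assms by (auto simp: doubleton_eq_iff)
  then have "a \<in> set (x # xs' @ [c])"
    using path_edges_subset by fast
  with Cons assms(1) show ?thesis by auto
qed

text \<open>The two paths share only the vertices \<open>a\<close> and \<open>c\<close>, so a common
  edge is \<open>{a, c}\<close>, and a path between \<open>a\<close> and \<open>c\<close> containing
  that edge has no inner vertex.\<close>

lemma two_paths_disjoint:
  assumes "distinct (a # xs @ c # ys)" "xs \<noteq> [] \<or> ys \<noteq> []"
  shows "path_edges (a # xs @ [c]) \<inter> path_edges (c # ys @ [a]) = {}"
proof (rule ccontr)
  assume "\<not> ?thesis"
  then obtain e where e: "e \<in> path_edges (a # xs @ [c])" "e \<in> path_edges (c # ys @ [a])"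
    by blast
  have "e \<subseteq> {a, c}"
    using path_edges_subset [OF e(1)] path_edges_subset [OF e(2)] assms(1) by auto
  moreover obtain u v where "u \<noteq> v" "e = {u, v}"
    using e(1) assms(1) by (auto elim: path_edges_doubleton [rotated])
  ultimately have "e = {a, c}" by auto
  with e have "xs = []" "ys = []"
    using assms(1) path_edges_closing [of a xs c] path_edges_closing [of c ys a]
    by (auto simp: insert_commute)
  with assms(2) show False by simp
qed

section \<open>Paths into a vertex set, and ears\<close>

lemma path_to_set:
  assumes "(b, m) \<in> {(x, y). {x, y} \<in> E}\<^sup>*" "m \<in> X"
  obtains ps where "ps \<noteq> []" "hd ps = b" "distinct ps" "path_edges ps \<subseteq> E"
    "last ps \<in> X" "set (butlast ps) \<inter> X = {}"
proof -
  have "\<exists>ps. ps \<noteq> [] \<and> hd ps = b \<and> distinct ps \<and> path_edges ps \<subseteq> E \<and>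
      last ps \<in> X \<and> set (butlast ps) \<inter> X = {}"
    using assms(1)
  proof (induction rule: converse_rtrancl_induct)
    case base
    show ?case using assms(2) by (intro exI [of _ "[m]"]) auto
  next
    case (step x y)
    then obtain ps where ps: "ps \<noteq> []" "hd ps = y" "distinct ps" "path_edges ps \<subseteq> E"
        "last ps \<in> X" "set (butlast ps) \<inter> X = {}"
      by blast
    consider "x \<in> X" | "x \<notin> X" "x \<in> set ps" | "x \<notin> X" "x \<notin> set ps" by blast
    then show ?case
    proof cases
      case 1
      then show ?thesis by (intro exI [of _ "[x]"]) auto
    next
      \<comment> \<open>Since \<open>x\<close> is already on the path, the suffix starting at
        \<open>x\<close> is taken; this keeps the vertices distinct.\<close>
      case 2
      then obtain us ws where split: "ps = us @ x # ws" by (meson split_list)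
      have "path_edges (x # ws) \<subseteq> E"
        using ps(4) path_edges_append [of us x ws] split by auto
      moreover have "set (butlast (x # ws)) \<inter> X = {}"
        using ps(6) unfolding split butlast_append by auto
      moreover have "last (x # ws) \<in> X" using ps(5) unfolding split by simp
      ultimately show ?thesis
        using ps(3) split by (intro exI [of _ "x # ws"] conjI) simp_all
    next
      case 3
      obtain qs where qs: "ps = y # qs" using ps(1,2) by (cases ps) auto
      have "path_edges (x # ps) \<subseteq> E" using ps(4) step(1) unfolding qs by simp
      then show ?thesis
        using ps 3 by (intro exI [of _ "x # ps"]) auto
    qed
  qed
  with that show thesis by blast
qed

lemma simple_edge_subset: "simple_graph K \<Longrightarrow> e \<in> edges K \<Longrightarrow> e \<subseteq> verts K"
  unfolding simple_graph_def by (metis empty_subsetI insert_subset)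

text \<open>If only an edge is missing, that edge is the ear. Otherwise a path from a missing vertex
  enters \<open>M\<close> at \<open>a\<close> through some \<open>b\<close> outside
  \<open>M\<close>. Since \<open>K\<close> without \<open>a\<close> is connected, a path from
  \<open>b\<close> reaches \<open>M\<close> at a vertex \<open>c\<close> different from
  \<open>a\<close>; prefixing \<open>a\<close> gives the ear.\<close>

lemma ear_exists:
  assumes K: "simple_graph K" "two_connected K"
    and M: "subgraph_of M K" "\<And>e. e \<in> edges M \<Longrightarrow> e \<subseteq> verts M"
      "u \<in> verts M" "v \<in> verts M" "u \<noteq> v"
    and neq: "verts M \<noteq> verts K \<or> edges M \<noteq> edges K"
  obtains a zs c where "a \<in> verts M" "c \<in> verts M" "distinct (a # zs @ [c])"
    "set zs \<inter> verts M = {}" "set zs \<subseteq> verts K"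
    "path_edges (a # zs @ [c]) \<subseteq> edges K" "path_edges (a # zs @ [c]) \<inter> edges M = {}"
proof (cases "verts M = verts K")
  case True
  with neq M(1) obtain e where e: "e \<in> edges K" "e \<notin> edges M"
    unfolding subgraph_of_def by blast
  then obtain a c where "a \<in> verts K" "c \<in> verts K" "a \<noteq> c" "e = {a, c}"
    using K(1) unfolding simple_graph_def by blast
  with e True show thesis by (intro that [of a c "[]"]) auto
next
  case False
  with M(1) obtain w where w: "w \<in> verts K" "w \<notin> verts M"
    unfolding subgraph_of_def by blast
  have "u \<in> verts K" using M unfolding subgraph_of_def by blast
  with w K(2) have "(w, u) \<in> {(x, y). {x, y} \<in> edges K}\<^sup>*"
    unfolding two_connected_def connected_graph_def by blast
  then obtain ps where ps: "ps \<noteq> []" "hd ps = w" "distinct ps" "path_edges ps \<subseteq> edges K"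
        "last ps \<in> verts M" "set (butlast ps) \<inter> verts M = {}"
    using M(3) by (rule path_to_set)
  define a where "a = last ps"
  have "butlast ps \<noteq> []"
    using ps(1,2,5) w(2) by (metis append_Nil append_butlast_last_id list.sel(1))
  then obtain us b where ub: "butlast ps = us @ [b]" by (metis rev_exhaust)
  then have split_ps: "ps = us @ b # [a]" unfolding a_def using ps(1)
    by (metis append.assoc append_Cons append_Nil append_butlast_last_id)
  have ba: "{b, a} \<in> edges K"
    by (rule subsetD [OF ps(4)]) (simp add: split_ps path_edges_append [of us b "[a]"])
  have bM: "b \<notin> verts M" using ps(6) unfolding ub by simp
  have aM: "a \<in> verts M" using ps(5) a_def by simp
  have "b \<noteq> a" using aM bM by metis
  have bK: "b \<in> verts K" using simple_edge_subset [OF K(1) ba] by simp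
  obtain m where m: "m \<in> verts M" "m \<noteq> a" using M(3-5) by metis
  define K' where "K' = delete_verts K {a}"
  have "a \<in> verts K" "m \<in> verts K" using aM m M(1) unfolding subgraph_of_def by blast+
  then have "(b, m) \<in> {(x, y). {x, y} \<in> edges K'}\<^sup>*"
    using K(2) bK \<open>b \<noteq> a\<close> m(2) unfolding two_connected_def connected_graph_def K'_def
    by (simp add: delete_verts_def)
  then obtain qs where qs: "qs \<noteq> []" "hd qs = b" "distinct qs" "path_edges qs \<subseteq> edges K'"
        "last qs \<in> verts M" "set (butlast qs) \<inter> verts M = {}"
    using m(1) by (rule path_to_set)
  define c zs where "c = last qs" and "zs = butlast qs"
  have "zs \<noteq> []" unfolding zs_def
    using qs(1,2,5) bM by (metis append_Nil append_butlast_last_id list.sel(1))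
  have split: "qs = zs @ [c]" unfolding c_def zs_def using qs(1) by simp
  have in_K': "e \<in> edges K \<and> a \<notin> e" if "e \<in> path_edges qs" for e
    using that qs(4) unfolding K'_def delete_verts_def by auto
  have len: "2 \<le> length qs" using \<open>zs \<noteq> []\<close> split by (cases zs) auto
  have set_qs: "x \<in> verts K \<and> x \<noteq> a" if x: "x \<in> set qs" for x
  proof -
    obtain e where "e \<in> path_edges qs" "x \<in> e" using path_edges_cover [OF len x] by blast
    with in_K' have "e \<in> edges K" "a \<notin> e" "x \<in> e" by auto
    with simple_edge_subset [OF K(1)] show ?thesis by blast
  qed
  obtain zs' where zs': "zs = b # zs'"
    using qs(2) \<open>zs \<noteq> []\<close> unfolding split by (cases zs) auto
  have pe: "path_edges (a # zs @ [c]) = insert {a, b} (path_edges qs)"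
    unfolding split zs' by simp
  show thesis
  proof (rule that [of a c zs])
    show "a \<in> verts M" "c \<in> verts M" "set zs \<inter> verts M = {}"
      using aM qs unfolding c_def zs_def by auto
    show "distinct (a # zs @ [c])" using qs(3) set_qs unfolding split by auto
    show "set zs \<subseteq> verts K" using set_qs unfolding split by auto
    show "path_edges (a # zs @ [c]) \<subseteq> edges K"
      unfolding pe using ba in_K' by (auto simp: insert_commute)
    show "path_edges (a # zs @ [c]) \<inter> edges M = {}"
    proof (rule ccontr)
      assume "\<not> ?thesis"
      then obtain e where e: "e \<in> path_edges (a # zs @ [c])" "e \<in> edges M" by blast
      from M(2) [OF e(2)] bM have eM: "e \<subseteq> verts M" "e \<noteq> {a, b}" by auto
      then have e': "e \<in> path_edges qs" using e unfolding pe by auto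
      then obtain x y where "x \<noteq> y" "e = {x, y}" using path_edges_doubleton [OF qs(3)] by metis
      moreover have "e \<subseteq> set zs \<union> {c}"
        using path_edges_subset [OF e'] unfolding split by simp
      then have "e \<subseteq> {c}"
        using eM(1) qs(6) unfolding zs_def by blast
      ultimately show False by auto
    qed
  qed
qed

section \<open>Cycles listed from a chosen vertex, and segments of them\<close>

definition cycle_list :: "('a, 'm) ugraph_scheme \<Rightarrow> 'a list \<Rightarrow> bool" where
  "cycle_list B vs \<longleftrightarrow> distinct vs \<and> 3 \<le> length vs \<and> verts B = set vs \<and>
     edges B = path_edges (vs @ [hd vs])"

lemma is_cycle_list: "is_cycle B \<longleftrightarrow> (\<exists>vs. cycle_list B vs)"
  unfolding is_cycle_iff cycle_list_def ..

lemma cycle_list_rotate: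
  assumes "cycle_list B (xs @ ys)" shows "cycle_list B (ys @ xs)"
proof (cases "xs = [] \<or> ys = []")
  case True
  with assms show ?thesis by auto
next
  case False
  then show ?thesis
    using assms cycle_edges_rotate [of xs ys] unfolding cycle_list_def by auto
qed

lemma cycle_list_at:
  assumes "is_cycle B" "v \<in> verts B"
  obtains ws where "cycle_list B (v # ws)"
proof -
  obtain ws where "distinct (v # ws)" "2 \<le> length ws" "verts B = set (v # ws)"
    "edges B = path_edges (v # ws @ [v])"
    using is_cycle_at [OF assms] .
  then have "cycle_list B (v # ws)" unfolding cycle_list_def by simp
  with that show thesis by blast
qed

lemma cycle_list_neighbours:
  assumes "cycle_list B (v # ws)"
  shows "{v, u} \<in> edges B \<longleftrightarrow> u = hd ws \<or> u = last ws" "ws \<noteq> []" "hd ws \<noteq> last ws"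
proof -
  have ws: "distinct (v # ws)" "ws \<noteq> []" "edges B = path_edges (v # ws @ [v])"
    using assms unfolding cycle_list_def by auto
  show "{v, u} \<in> edges B \<longleftrightarrow> u = hd ws \<or> u = last ws"
    unfolding ws(3) by (rule path_edges_end [OF ws(1,2)])
  show "ws \<noteq> []" by fact
  obtain a b ws' where "ws = a # b # ws'"
    using assms unfolding cycle_list_def by (cases ws; cases "tl ws") auto
  then show "hd ws \<noteq> last ws" using ws(1) by auto
qed

text \<open>The two neighbours of \<open>v\<close> are the ends of the path \<open>ws\<close>; an
  edge of the cycle joining them must be all of that path, so the cycle is a triangle.\<close>

lemma cycle_list_ends_adjacent:
  assumes "cycle_list B (v # ws)" "{hd ws, last ws} \<in> edges B"
  shows "set ws = {hd ws, last ws}" "length ws = 2"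
proof -
  have ws: "distinct (v # ws)" "2 \<le> length ws" "edges B = path_edges (v # ws @ [v])"
    using assms unfolding cycle_list_def by auto
  obtain a ws' where a: "ws = a # ws'" using ws(2) by (cases ws) auto
  have "ws' \<noteq> []" using ws(2) a by auto
  then obtain mid c where split: "ws = a # mid @ [c]"
    using a by (metis rev_exhaust)
  have "path_edges (v # ws @ [v]) = insert {v, a} (insert {c, v} (path_edges ws))"
    using path_edges_append [of "a # mid" c "[v]"] unfolding split by auto
  moreover have "{a, c} \<noteq> {v, a}" "{a, c} \<noteq> {c, v}"
    using ws(1) unfolding split by (auto simp: doubleton_eq_iff)
  ultimately have "{a, c} \<in> path_edges ws"
    using assms(2) unfolding ws(3) by (simp add: split)
  then have "mid = []"
    using ws(1) path_edges_closing [of a mid c] unfolding split by simp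
  then show "set ws = {hd ws, last ws}" "length ws = 2" unfolding split by simp_all
qed

text \<open>This links the length in the definition of large faces to adjacency: the boundary of any
  other face is a triangle, while that of a large face has two nonadjacent vertices.\<close>

lemma cycle_pairwise_adjacent:
  assumes "is_cycle B"
  shows "(\<forall>x\<in>verts B. \<forall>y\<in>verts B. x \<noteq> y \<longrightarrow> {x, y} \<in> edges B) \<longleftrightarrow> card (edges B) < 4"
proof -
  obtain vs where vs: "cycle_list B vs" using assms unfolding is_cycle_list ..
  then obtain v ws where v: "vs = v # ws" by (cases vs) (auto simp: cycle_list_def)
  have card: "card (edges B) = length vs"
    using vs card_cycle_edges unfolding cycle_list_def by metis
  have len: "2 \<le> length ws" using vs unfolding v cycle_list_def by simp
  show ?thesis
  proof
    assume *: "\<forall>x\<in>verts B. \<forall>y\<in>verts B. x \<noteq> y \<longrightarrow> {x, y} \<in> edges B"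
    note nb = cycle_list_neighbours(2,3) [OF vs [unfolded v]]
    have "hd ws \<in> verts B" "last ws \<in> verts B"
      using vs nb(1) unfolding cycle_list_def v by auto
    with * nb have "{hd ws, last ws} \<in> edges B" by blast
    then have "length ws = 2" by (rule cycle_list_ends_adjacent [OF vs [unfolded v]])
    then show "card (edges B) < 4" using card v by simp
  next
    assume "card (edges B) < 4"
    then have "length ws = 2" using card len v by simp
    then obtain a b where "ws = [a, b]"
      by (metis One_nat_def Suc_1 length_0_conv length_Suc_conv)
    then have "verts B = {v, a, b}" "edges B = {{v, a}, {a, b}, {b, v}}"
      using vs unfolding v cycle_list_def by auto
    then show "\<forall>x\<in>verts B. \<forall>y\<in>verts B. x \<noteq> y \<longrightarrow> {x, y} \<in> edges B"
      by (simp add: insert_commute)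
  qed
qed

text \<open>A vertex of \<open>X\<close> can be accompanied only by its two neighbours, and by both
  only if these are adjacent; the cycle is then a triangle contained in \<open>X\<close>, which is
  excluded. So \<open>X\<close> is empty, a vertex or an edge, and a rotation moves it to the front
  of the list.\<close>

lemma clique_in_cycle:
  assumes B: "is_cycle B" and X: "X \<subseteq> verts B" "X \<noteq> verts B"
    and adj: "\<And>x y. x \<in> X \<Longrightarrow> y \<in> X \<Longrightarrow> x \<noteq> y \<Longrightarrow> {x, y} \<in> edges B"
  obtains cs rest where "cycle_list B (cs @ rest)" "set cs = X" "rest \<noteq> []" "length cs \<le> 2"
proof -
  have "\<exists>cs rest. cycle_list B (cs @ rest) \<and> set cs = X \<and> length cs \<le> 2"
  proof (cases "X = {}")
    case True
    then show ?thesis using B unfolding is_cycle_list by (metis append_Nil le0 list.set(1) list.size(3))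
  next
    case False
    then obtain x where x: "x \<in> X" by blast
    then obtain ws where ws: "cycle_list B (x # ws)"
      using cycle_list_at [OF B, of x] X(1) by blast
    note nb = cycle_list_neighbours [OF ws]
    have sub: "X \<subseteq> {x, hd ws, last ws}"
      using adj [OF x] nb(1) by blast
    consider "X = {x}" | "X = {x, hd ws}" | "X = {x, last ws}"
      | "hd ws \<in> X" "last ws \<in> X"
      using sub x by blast
    then show ?thesis
    proof cases
      case 1
      show ?thesis
      proof (intro exI conjI)
        show "cycle_list B ([x] @ ws)" using ws by simp
      qed (use 1 in auto)
    next
      case 2
      show ?thesis
      proof (intro exI conjI)
        show "cycle_list B ([x, hd ws] @ tl ws)" using ws nb(2) by simp
      qed (use 2 in auto)
    next
      case 3
      have "cycle_list B ((x # butlast ws) @ [last ws])" using ws nb(2) by simp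
      then have *: "cycle_list B ([last ws, x] @ butlast ws)"
        using cycle_list_rotate by fastforce
      show ?thesis
      proof (intro exI conjI)
        show "cycle_list B ([last ws, x] @ butlast ws)" by (fact *)
      qed (use 3 in auto)
    next
      case 4
      then have "{hd ws, last ws} \<in> edges B" using adj nb(3) by blast
      then have "set ws = {hd ws, last ws}" by (rule cycle_list_ends_adjacent(1) [OF ws])
      then have "verts B \<subseteq> X" using 4 x ws unfolding cycle_list_def by auto
      with X show ?thesis by blast
    qed
  qed
  then obtain cs rest where cr: "cycle_list B (cs @ rest)" "set cs = X" "length cs \<le> 2" by blast
  moreover have "rest \<noteq> []" using cr X(2) unfolding cycle_list_def by auto
  ultimately show thesis using that by blast
qed

lemma cycle_list_edges:
  assumes "cycle_list B (cs @ rest)" "rest \<noteq> []"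
  shows "path_edges rest \<subseteq> edges B"
    and "cs \<noteq> [] \<Longrightarrow> {last cs, hd rest} \<in> edges B"
    and "cs \<noteq> [] \<Longrightarrow> {hd cs, last rest} \<in> edges B"
proof -
  obtain r rest' where r: "rest = r # rest'" using assms(2) by (cases rest) auto
  obtain us z where z: "rest = us @ [z]" using assms(2) by (metis rev_exhaust)
  let ?h = "hd (cs @ rest)"
  have e: "edges B = path_edges (cs @ rest @ [?h])"
    using assms(1) unfolding cycle_list_def by simp
  then have e1: "edges B = path_edges (cs @ [r]) \<union> path_edges (rest @ [?h])"
    using path_edges_append [of cs r "rest' @ [?h]"] unfolding r by simp
  have e2: "path_edges (rest @ [?h]) = path_edges rest \<union> {{z, ?h}}"
    using path_edges_append [of us z "[?h]"] unfolding z by simp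
  show "path_edges rest \<subseteq> edges B" unfolding e1 e2 by blast
  assume "cs \<noteq> []"
  then show "{hd cs, last rest} \<in> edges B"
    unfolding e1 e2 by (simp add: z insert_commute)
  obtain us' y where y: "cs = us' @ [y]" using \<open>cs \<noteq> []\<close> by (metis rev_exhaust)
  have "{y, r} \<in> path_edges (cs @ [r])"
    using path_edges_append [of us' y "[r]"] unfolding y by simp
  then show "{last cs, hd rest} \<in> edges B"
    unfolding e1 by (simp add: r y)
qed

section \<open>Reachability, and 2-connectedness of an extended graph\<close>

lemma rtrancl_edges_sym:
  "(u, v) \<in> {(a, b). {a, b} \<in> E}\<^sup>* \<Longrightarrow> (v, u) \<in> {(a, b). {a, b} \<in> E}\<^sup>*"
  by (rule symD [OF sym_rtrancl]) (auto simp: sym_def insert_commute)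

lemma path_connected_edges:
  assumes "path_edges ps \<subseteq> E" "u \<in> set ps" "v \<in> set ps"
  shows "(u, v) \<in> {(a, b). {a, b} \<in> E}\<^sup>*"
proof -
  have "\<forall>v\<in>set ps. (hd ps, v) \<in> {(a, b). {a, b} \<in> E}\<^sup>*"
    using assms(1)
  proof (induction ps rule: path_edges.induct)
    case (1 x y zs)
    then have "(x, y) \<in> {(a, b). {a, b} \<in> E}" by simp
    moreover have "\<forall>v\<in>set (y # zs). (y, v) \<in> {(a, b). {a, b} \<in> E}\<^sup>*" using 1 by simp
    ultimately show ?case by (auto intro: converse_rtrancl_into_rtrancl)
  qed auto
  then have "(hd ps, u) \<in> {(a, b). {a, b} \<in> E}\<^sup>*" "(hd ps, v) \<in> {(a, b). {a, b} \<in> E}\<^sup>*"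
    using assms(2,3) by blast+
  then show ?thesis by (rule rtrancl_trans [OF rtrancl_edges_sym])
qed

text \<open>Of the two neighbours in \<open>G\<close> of a new vertex, at least one survives the
  deletion of a single vertex, so every remaining vertex reaches what is left of
  \<open>G\<close>.\<close>

lemma two_connected_extend:
  assumes G: "simple_graph G" "two_connected G" and K: "subgraph_of G K" "finite (verts K)"
    and new: "\<And>x. x \<in> verts K - verts G \<Longrightarrow>
      \<exists>y\<in>verts G. \<exists>z\<in>verts G. y \<noteq> z \<and> {x, y} \<in> edges K \<and> {x, z} \<in> edges K"
  shows "two_connected K"
proof -
  have sub: "verts G \<subseteq> verts K" "edges G \<subseteq> edges K" using K(1) unfolding subgraph_of_def by auto
  \<comment> \<open>With \<open>X\<close> empty or a singleton, connectedness and the deletion of a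
    vertex are treated together.\<close>
  have conn: "connected_graph (delete_verts K X)"
    if X: "X \<subseteq> {w}" and c: "connected_graph (delete_verts G X)" for X w
  proof -
    let ?R = "{(a, b). {a, b} \<in> edges (delete_verts K X)}"
    have G_path: "(u, v) \<in> ?R\<^sup>*" if "u \<in> verts G - X" "v \<in> verts G - X" for u v
    proof -
      have "(u, v) \<in> {(a, b). {a, b} \<in> edges (delete_verts G X)}\<^sup>*"
        using c that unfolding connected_graph_def by (simp add: delete_verts_def)
      moreover have "{(a, b). {a, b} \<in> edges (delete_verts G X)} \<subseteq> ?R"
        using sub(2) unfolding delete_verts_def by auto
      ultimately show ?thesis using rtrancl_mono by blast
    qed
    have to_G: "\<exists>y\<in>verts G - X. (x, y) \<in> ?R\<^sup>*" if x: "x \<in> verts K - X" for x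
    proof (cases "x \<in> verts G")
      case True
      with x show ?thesis by blast
    next
      case False
      then obtain y z where yz: "y \<in> verts G" "z \<in> verts G" "y \<noteq> z"
          "{x, y} \<in> edges K" "{x, z} \<in> edges K"
        using new x by blast
      then obtain t where "t \<in> verts G" "t \<notin> X" "{x, t} \<in> edges K" using X by blast
      then have "t \<in> verts G - X" "(x, t) \<in> ?R" using x unfolding delete_verts_def by auto
      then show ?thesis by blast
    qed
    show ?thesis
      unfolding connected_graph_def
    proof (intro ballI)
      fix u v assume "u \<in> verts (delete_verts K X)" "v \<in> verts (delete_verts K X)"
      then have "u \<in> verts K - X" "v \<in> verts K - X" by (simp_all add: delete_verts_def)
      then obtain y z where yz: "y \<in> verts G - X" "(u, y) \<in> ?R\<^sup>*" "z \<in> verts G - X" "(v, z) \<in> ?R\<^sup>*"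
        using to_G by metis
      have "(u, z) \<in> ?R\<^sup>*"
        using yz(2) G_path [OF yz(1,3)] by (rule rtrancl_trans)
      then show "(u, v) \<in> ?R\<^sup>*"
        using rtrancl_edges_sym [OF yz(4)] by (rule rtrancl_trans)
    qed
  qed
  have del_empty: "connected_graph (delete_verts G {}) = connected_graph G"
      "connected_graph (delete_verts K {}) = connected_graph K"
    unfolding connected_graph_def delete_verts_def by simp_all
  have cG: "connected_graph (delete_verts G {})"
    unfolding del_empty using G(2) unfolding two_connected_def by blast
  have "connected_graph K" using conn [OF _ cG] unfolding del_empty by blast
  moreover have "connected_graph (delete_verts K {v})" for v
  proof (cases "v \<in> verts G")
    case True
    then have "connected_graph (delete_verts G {v})" using G(2) unfolding two_connected_def by blast
    with conn show ?thesis by blast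
  next
    case False
    \<comment> \<open>Deleting a new vertex leaves \<open>G\<close> intact, so here the
      connectedness of \<open>G\<close> itself is the input.\<close>
    then have "e \<inter> {v} = {}" if "e \<in> edges G" for e
      using simple_edge_subset [OF G(1) that] by blast
    then have "delete_verts G {v} = delete_verts G {}"
      using False unfolding delete_verts_def by auto
    with conn [of "{v}" v] cG show ?thesis by simp
  qed
  moreover have "3 \<le> card (verts K)"
    using G(2) card_mono [OF K(2) sub(1)] unfolding two_connected_def by linarith
  ultimately show ?thesis unfolding two_connected_def by blast
qed


section \<open>Jordan curves and theta graphs\<close>

text \<open>The inverse of the parametrization would embed a nonempty open set of the plane into the
  line, against invariance of dimension.\<close>

lemma interior_arc_image_empty:
  fixes g :: "real \<Rightarrow> complex"
  assumes "arc g" shows "interior (path_image g) = {}"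
proof (rule ccontr)
  assume ne: "interior (path_image g) \<noteq> {}"
  obtain h where h: "homeomorphism {0..1} (path_image g) g h"
    using homeomorphism_arc [OF assms] by blast
  have "continuous_on (interior (path_image g)) h"
    using h interior_subset by (meson continuous_on_subset homeomorphism_def)
  moreover have "inj_on h (interior (path_image g))"
    using h interior_subset by (metis homeomorphism_def inj_on_inverseI subset_iff)
  ultimately have "DIM(complex) \<le> DIM(real)"
    using invariance_of_dimension ne by blast
  then show False by simp
qed

lemma interior_Union_finite_empty:
  assumes "finite \<X>" "\<And>X. X \<in> \<X> \<Longrightarrow> closed X \<and> interior X = {}"
  shows "interior (\<Union>\<X>) = {}"
  using assms
proof (induction \<X> rule: finite_induct)
  case (insert X \<X>)
  then have "interior (X \<union> \<Union>\<X>) = interior X"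
    by (intro interior_closed_Un_empty_interior) auto
  with insert show ?case by simp
qed simp

text \<open>A strictly larger connected set would meet the frontier of \<open>\<phi>\<close>, hence
  \<open>X\<close>. This is the standard way below of recognising a face as a component of the
  complement of a smaller graph.\<close>

lemma componentsI_frontier:
  fixes X :: "'a::real_normed_vector set"
  assumes "connected \<phi>" "\<phi> \<noteq> {}" "\<phi> \<inter> X = {}" "frontier \<phi> \<subseteq> X"
  shows "\<phi> \<in> components (- X)"
  unfolding in_components_maximal
proof (intro conjI allI impI)
  fix D assume D: "D \<noteq> {} \<and> \<phi> \<subseteq> D \<and> D \<subseteq> - X \<and> connected D"
  show "D = \<phi>"
  proof (rule ccontr)
    assume "D \<noteq> \<phi>"
    with D have "D \<inter> \<phi> \<noteq> {}" "D - \<phi> \<noteq> {}" using assms(2) by auto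
    with D have "D \<inter> frontier \<phi> \<noteq> {}" by (intro connected_Int_frontier) auto
    with D assms(4) show False by auto
  qed
qed (use assms in auto)

text \<open>The conclusion of the Jordan curve theorem, phrased without telling the bounded side
  from the unbounded one, since the theta argument is symmetric in the two.\<close>

definition jordan_set :: "complex set \<Rightarrow> bool" where
  "jordan_set X \<longleftrightarrow> compact X \<and>
     (\<exists>D E. components (- X) = {D, E} \<and> D \<noteq> E \<and> frontier D = X \<and> frontier E = X)"

lemma Jordan_components:
  fixes c :: "real \<Rightarrow> complex"
  assumes "simple_path c" "pathfinish c = pathstart c"
  shows "components (- path_image c) = {inside (path_image c), outside (path_image c)}"
    and "inside (path_image c) \<noteq> outside (path_image c)"
proof -
  let ?X = "path_image c"
  note J = Jordan_inside_outside [OF assms]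
  have in_io: "inside ?X \<in> components (- ?X)" "outside ?X \<in> components (- ?X)"
    using J by (intro componentsI_frontier; auto)+
  moreover have "D = inside ?X \<or> D = outside ?X" if D: "D \<in> components (- ?X)" for D
  proof -
    have "D \<noteq> {}" by (rule in_components_nonempty [OF D])
    moreover have "D \<subseteq> inside ?X \<union> outside ?X"
      using in_components_subset [OF D] by simp
    ultimately show ?thesis
      using components_eq [OF D] in_io by blast
  qed
  ultimately show "components (- ?X) = {inside ?X, outside ?X}"
    by blast
  show "inside ?X \<noteq> outside ?X"
    using J by auto
qed

lemma jordan_set_path_image:
  fixes c :: "real \<Rightarrow> complex"
  assumes "simple_path c" "pathfinish c = pathstart c"
  shows "jordan_set (path_image c)"
proof -
  have "compact (path_image c)"
    using assms(1) by (simp add: compact_simple_path_image)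
  moreover have "frontier (inside (path_image c)) = path_image c"
      "frontier (outside (path_image c)) = path_image c"
    using Jordan_inside_outside [OF assms] by simp_all
  ultimately show ?thesis
    unfolding jordan_set_def using Jordan_components [OF assms] by metis
qed

lemma jordan_set_arcs:
  fixes g h :: "real \<Rightarrow> complex"
  assumes "arc g" "arc h" "pathstart g = pathstart h" "pathfinish g = pathfinish h"
    "path_image g \<inter> path_image h = {pathstart g, pathfinish g}"
  shows "jordan_set (path_image g \<union> path_image h)"
proof -
  have "simple_path (g +++ reversepath h)"
    using assms by (intro simple_path_join_loop) (auto simp: arc_reversepath)
  moreover have "path_image (g +++ reversepath h) = path_image g \<union> path_image h"
    using assms by (simp add: path_image_join)
  ultimately show ?thesis
    using jordan_set_path_image [of "g +++ reversepath h"] assms by simp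
qed

text \<open>The connected set \<open>U - X\<close> lies on one side of \<open>X\<close>. Either the
  side \<open>D\<close> containing \<open>\<phi>\<close> is free of \<open>U\<close> and equals
  \<open>\<phi>\<close>, or \<open>U - X\<close> lies in \<open>D\<close> and the far side
  \<open>E\<close> remains a component.\<close>

lemma component_extending_jordan_set:
  assumes J: "jordan_set X" and "X \<subseteq> U" and conn: "connected (U - X)"
    and \<phi>: "\<phi> \<in> components (- U)"
  shows "frontier \<phi> = X \<or> (\<exists>D E. components (- X) = {D, E} \<and> \<phi> \<subseteq> D \<and> D \<inter> E = {} \<and>
      E \<in> components (- U) \<and> frontier E = X)"
proof -
  obtain D E where DE: "components (- X) = {D, E}" "D \<noteq> E" "frontier D = X" "frontier E = X"
      "\<phi> \<subseteq> D"
  proof -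
    obtain D E where DE: "components (- X) = {D, E}" "D \<noteq> E" "frontier D = X" "frontier E = X"
      using J unfolding jordan_set_def by blast
    obtain Y where "Y \<in> components (- X)" "\<phi> \<subseteq> Y"
      using exists_component_superset [of \<phi> "- X"] \<phi> \<open>X \<subseteq> U\<close>
      by (metis Compl_anti_mono components_eq_empty emptyE in_components_connected
          in_components_nonempty in_components_subset subset_empty subset_trans)
    then show thesis using DE that by (metis insertE insert_commute singletonD)
  qed
  have comp: "D \<in> components (- X)" "E \<in> components (- X)" using DE by auto
  have disj: "D \<inter> E = {}" using components_nonoverlap [OF comp] DE by simp
  show ?thesis
  proof (cases "D \<inter> U = {}")
    case True
    have "D = \<phi>"
      using \<phi> DE True in_components_connected [OF comp(1)] in_components_nonempty [OF comp(1)]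
      unfolding in_components_maximal by (metis disjoint_eq_subset_Compl)
    with DE show ?thesis by blast
  next
    case False
    then have "(U - X) \<inter> D \<noteq> {}"
      using in_components_subset [OF comp(1)] by blast
    then have "U - X \<subseteq> D"
      using components_maximal [OF comp(1) conn] by blast
    then have "E \<inter> U = {}"
      using disj in_components_subset [OF comp(2)] by blast
    then have "E \<in> components (- U)"
      using DE \<open>X \<subseteq> U\<close> comp(2)
      by (intro componentsI_frontier) (auto simp: in_components_connected in_components_nonempty)
    with DE disj show ?thesis by blast
  qed
qed

text \<open>Otherwise \<open>\<phi>\<close> would be a fourth component next to the far sides of the three curves; but the
  far side \<open>E\<close> of \<open>P \<union> Q\<close> is separated from \<open>\<phi>\<close> neither by \<open>Q \<union> R\<close> nor by \<open>P \<union> R\<close>, hence by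
  Janiszewski's theorem not by their union.\<close>

lemma theta_components:
  assumes J: "jordan_set (P \<union> Q)" "jordan_set (Q \<union> R)" "jordan_set (P \<union> R)"
    and conn: "connected R" "connected (P - (Q \<union> R))" "connected (Q - (P \<union> R))"
      "connected (R - (P \<union> Q))"
    and ne: "\<not> P \<subseteq> Q \<union> R" "\<not> Q \<subseteq> P \<union> R"
    and PQ: "P \<inter> Q \<subseteq> R"
    and \<phi>: "\<phi> \<in> components (- (P \<union> Q \<union> R))"
  shows "frontier \<phi> \<in> {P \<union> Q, Q \<union> R, P \<union> R}"
proof (rule ccontr)
  let ?U = "P \<union> Q \<union> R"
  assume *: "\<not> ?thesis"
  have d: "?U - (P \<union> Q) = R - (P \<union> Q)" "?U - (Q \<union> R) = P - (Q \<union> R)"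
      "?U - (P \<union> R) = Q - (P \<union> R)"
    by blast+
  have "connected (?U - (P \<union> Q))" "connected (?U - (Q \<union> R))" "connected (?U - (P \<union> R))"
    unfolding d by (fact conn)+
  note ext = component_extending_jordan_set [OF J(1) _ this(1) \<phi>]
    component_extending_jordan_set [OF J(2) _ this(2) \<phi>]
    component_extending_jordan_set [OF J(3) _ this(3) \<phi>]
  obtain D E where DE: "components (- (P \<union> Q)) = {D, E}" "\<phi> \<subseteq> D" "D \<inter> E = {}"
      "E \<in> components (- ?U)" "frontier E = P \<union> Q"
    using ext(1) * by blast
  obtain D1 E1 where DE1: "components (- (Q \<union> R)) = {D1, E1}" "\<phi> \<subseteq> D1" "D1 \<inter> E1 = {}"
      "E1 \<in> components (- ?U)" "frontier E1 = Q \<union> R"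
    using ext(2) * by blast
  obtain D2 E2 where DE2: "components (- (P \<union> R)) = {D2, E2}" "\<phi> \<subseteq> D2" "D2 \<inter> E2 = {}"
      "E2 \<in> components (- ?U)" "frontier E2 = P \<union> R"
    using ext(3) * by blast
  have E: "connected E" "E \<noteq> {}" "E \<inter> ?U = {}"
    using DE(4) in_components_connected in_components_nonempty in_components_subset by blast+
  \<comment> \<open>Components with different frontiers are different, so \<open>E\<close> is
    disjoint from the far side \<open>E'\<close> of the other curve and must lie on the side of
    \<open>\<phi>\<close>.\<close>
  have sub: "E \<subseteq> D'" if "components (- X) = {D', E'}" "E' \<in> components (- ?U)"
    "frontier E' \<noteq> P \<union> Q" "X \<subseteq> ?U" for X D' E'
  proof -
    have "E \<inter> E' = {}"
      using components_nonoverlap [OF DE(4) that(2)] DE(5) that(3) by blast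
    moreover have "E \<subseteq> D' \<union> E'"
      using Union_components [of "- X"] that(1,4) E(3) by auto
    ultimately show ?thesis by blast
  qed
  have "E \<subseteq> D1" using sub [OF DE1(1) DE1(4)] DE1(5) ne by blast
  have "E \<subseteq> D2" using sub [OF DE2(1) DE2(4)] DE2(5) ne by blast
  have "\<phi> \<noteq> {}" using \<phi> by (rule in_components_nonempty)
  then obtain p q where pq: "p \<in> \<phi>" "q \<in> E" using E(2) by blast
  have cc: "connected_component (- X) p q"
    if "components (- X) = {D', E'}" "\<phi> \<subseteq> D'" "E \<subseteq> D'" for X D' E'
  proof -
    have "D' \<in> components (- X)" using that(1) by simp
    then have "connected D'" "D' \<subseteq> - X"
      by (rule in_components_connected, rule in_components_subset)
    then show ?thesis
      unfolding connected_component_def using that pq by (intro exI [of _ D'] conjI) auto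
  qed
  have "connected_component (- (Q \<union> R)) p q" "connected_component (- (P \<union> R)) p q"
    using cc [OF DE1(1,2) \<open>E \<subseteq> D1\<close>] cc [OF DE2(1,2) \<open>E \<subseteq> D2\<close>] by blast+
  \<comment> \<open>The two curves have exactly \<open>R\<close> in common, because \<open>P\<close>
    and \<open>Q\<close> meet only in points of \<open>R\<close>; this provides the connected
    intersection that Janiszewski's theorem asks for.\<close>
  moreover have "connected ((Q \<union> R) \<inter> (P \<union> R))"
  proof -
    have "(Q \<union> R) \<inter> (P \<union> R) = R" using PQ by blast
    then show ?thesis using conn(1) by simp
  qed
  moreover have "compact (Q \<union> R)" "closed (P \<union> R)"
    using J(2,3) by (simp_all add: jordan_set_def compact_imp_closed)
  ultimately have "connected_component (- ((Q \<union> R) \<union> (P \<union> R))) p q"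
    using Janiszewski by blast
  moreover have "(Q \<union> R) \<union> (P \<union> R) = ?U" by blast
  ultimately have cc: "connected_component (- ?U) p q" by simp
  have "\<phi> = E"
  proof (rule joinable_components_eq [of "{x. connected_component (- ?U) p x}" "- ?U"], intro conjI)
    show "connected (Collect (connected_component (- ?U) p))"
      by (rule connected_connected_component)
    show "Collect (connected_component (- ?U) p) \<subseteq> - ?U"
      by (rule connected_component_subset)
    have "p \<in> Collect (connected_component (- ?U) p)" using cc
      by (metis connected_component_refl_eq connected_component_in mem_Collect_eq)
    then show "\<phi> \<inter> Collect (connected_component (- ?U) p) \<noteq> {}" using pq by blast
    show "E \<inter> Collect (connected_component (- ?U) p) \<noteq> {}" using pq cc by blast
  qed (use \<phi> DE in auto)
  with DE E show False by blast
qed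

lemma theta_arcs:
  fixes g h k :: "real \<Rightarrow> complex"
  assumes arcs: "arc g" "arc h" "arc k"
    and ends: "pathstart g = a" "pathfinish g = b" "pathstart h = a" "pathfinish h = b"
      "pathstart k = a" "pathfinish k = b"
    and int: "path_image g \<inter> path_image h = {a, b}" "path_image g \<inter> path_image k = {a, b}"
      "path_image h \<inter> path_image k = {a, b}"
    and \<phi>: "\<phi> \<in> components (- (path_image g \<union> path_image h \<union> path_image k))"
  shows "frontier \<phi> \<in> {path_image g \<union> path_image h, path_image h \<union> path_image k,
    path_image g \<union> path_image k}"
proof (rule theta_components [OF _ _ _ _ _ _ _ _ _ _ \<phi>])
  have conn: "connected (path_image f - {a, b})" "\<not> path_image f \<subseteq> {a, b}"
    if "arc f" "pathstart f = a" "pathfinish f = b" for f :: "real \<Rightarrow> complex"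
  proof -
    show "connected (path_image f - {a, b})"
      using connected_simple_path_endless [of f] that arc_imp_simple_path by fastforce
    show "\<not> path_image f \<subseteq> {a, b}"
      using simple_path_endless [of f] that arc_imp_simple_path
      by (metis Diff_eq_empty_iff connected_simple_path_endless nonempty_simple_path_endless)
  qed
  have "path_image g - (path_image h \<union> path_image k) = path_image g - {a, b}"
    "path_image h - (path_image g \<union> path_image k) = path_image h - {a, b}"
    "path_image k - (path_image g \<union> path_image h) = path_image k - {a, b}"
    using int by blast+
  then show "connected (path_image g - (path_image h \<union> path_image k))"
    "connected (path_image h - (path_image g \<union> path_image k))"
    "connected (path_image k - (path_image g \<union> path_image h))"
    using conn arcs ends by simp_all
  show "\<not> path_image g \<subseteq> path_image h \<union> path_image k" "\<not> path_image h \<subseteq> path_image g \<union> path_image k"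
    using conn arcs ends int by blast+
  show "jordan_set (path_image g \<union> path_image h)" "jordan_set (path_image h \<union> path_image k)"
    "jordan_set (path_image g \<union> path_image k)"
    using arcs ends int by (intro jordan_set_arcs; simp)+
  show "connected (path_image k)" using arcs connected_arc_image by blast
  show "path_image g \<inter> path_image h \<subseteq> path_image k"
    using int by blast
qed

text \<open>Points of \<open>P\<close> outside the closure would form a finite, hence closed, set
  that splits \<open>P\<close>. It is applied to an arc and its end points.\<close>

lemma connected_subset_closure_Diff:
  fixes P :: "'a::t1_space set"
  assumes "connected P" "finite E" "P - E \<noteq> {}"
  shows "P \<subseteq> closure (P - E)"
proof (rule ccontr)
  assume n: "\<not> ?thesis"
  have "closed (E - closure (P - E) :: 'a set)"
    using assms(2) by (simp add: finite_imp_closed)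
  moreover have "P \<inter> closure (P - E) \<noteq> {}"
    using assms(3) closure_subset [of "P - E"] by blast
  moreover have "P \<inter> (E - closure (P - E)) \<noteq> {}"
    using n closure_subset [of "P - E"] by blast
  moreover have "P \<subseteq> closure (P - E) \<union> (E - closure (P - E))"
    using closure_subset [of "P - E"] by blast
  ultimately show False
    using assms(1) closed_closure [of "P - E"] unfolding connected_closed by blast
qed

lemma component_sub_Compl:
  assumes "\<phi> \<in> components (- Y)" "X \<subseteq> Y"
  obtains F where "F \<in> components (- X)" "\<phi> \<subseteq> F"
proof -
  have sub: "\<phi> \<subseteq> - X" using in_components_subset [OF assms(1)] assms(2) by blast
  moreover have "\<phi> \<noteq> {}" using assms(1) by (rule in_components_nonempty)
  ultimately have "- X \<noteq> {}" by blast
  with sub that show thesis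
    using exists_component_superset [OF sub] in_components_connected [OF assms(1)] by blast
qed


section \<open>Faces of 2-connected plane graphs\<close>

locale plane =
  fixes H :: plane_drawing
  assumes plane_graph: "plane_graph H"
begin

lemma simple: "simple_graph H"
  using plane_graph unfolding plane_graph_def by blast

lemma edge_subset: "e \<in> edges H \<Longrightarrow> e \<subseteq> verts H"
  by (rule simple_edge_subset [OF simple])

lemma finite_verts: "finite (verts H)"
  using simple unfolding simple_graph_def by blast

lemma finite_edges: "finite (edges H)"
  using edge_subset finite_verts by (meson Pow_iff finite_Pow_iff finite_subset subsetI)

lemma edge_arc:
  assumes "{u, v} \<in> edges H"
  obtains g where "arc g" "path_image g = arc_of H {u, v}" "pathstart g = u" "pathfinish g = v"
proof -
  obtain g where g: "arc g" "path_image g = arc_of H {u, v}" "{pathstart g, pathfinish g} = {u, v}"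
    using plane_graph assms unfolding plane_graph_def by metis
  then consider "pathstart g = u" "pathfinish g = v" | "pathstart g = v" "pathfinish g = u"
    by (auto simp: doubleton_eq_iff)
  then show thesis
  proof cases
    case 1
    with g that show thesis by blast
  next
    case 2
    with g that [of "reversepath g"] show thesis by (simp add: arc_reversepath)
  qed
qed

lemma edge_ends:
  assumes "e \<in> edges H"
  obtains u v where "u \<noteq> v" "e = {u, v}"
  using simple assms unfolding simple_graph_def by blast

lemma arc_facts:
  assumes "e \<in> edges H"
  shows "e \<subseteq> arc_of H e" "closed (arc_of H e)" "compact (arc_of H e)"
    "interior (arc_of H e) = {}" "connected (arc_of H e - e)" "arc_of H e - e \<noteq> {}"
proof -
  obtain u v where uv: "e = {u, v}" using edge_ends [OF assms] by metis
  then obtain g where g: "arc g" "path_image g = arc_of H e" "pathstart g = u" "pathfinish g = v"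
    using edge_arc assms by metis
  show "e \<subseteq> arc_of H e"
    using g uv pathstart_in_path_image [of g] pathfinish_in_path_image [of g] by simp
  show "closed (arc_of H e)" "compact (arc_of H e)" "interior (arc_of H e) = {}"
    using closed_arc_image [OF g(1)] compact_arc_image [OF g(1)] interior_arc_image_empty [OF g(1)]
    unfolding g(2) by blast+
  show "connected (arc_of H e - e)" "arc_of H e - e \<noteq> {}"
    using connected_simple_path_endless [OF arc_imp_simple_path [OF g(1)]]
      nonempty_simple_path_endless [OF arc_imp_simple_path [OF g(1)]]
    unfolding g(2-4) uv by blast+
qed

lemma vertex_on_arc: "v \<in> verts H \<Longrightarrow> e \<in> edges H \<Longrightarrow> v \<in> arc_of H e \<longleftrightarrow> v \<in> e"
proof -
  assume ve: "v \<in> verts H" "e \<in> edges H"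
  then have "(arc_of H e - e) \<inter> verts H = {}"
    using plane_graph unfolding plane_graph_def by metis
  with ve(1) arc_facts(1) [OF ve(2)] show ?thesis by blast
qed

lemma open_arc_disjoint:
  assumes "e \<in> edges H" "f \<in> edges H" "e \<noteq> f" "p \<in> arc_of H e" "p \<notin> e"
  shows "p \<notin> arc_of H f"
proof -
  have "\<forall>e\<in>edges H. \<forall>f\<in>edges H. e \<noteq> f \<longrightarrow> (arc_of H e - e) \<inter> arc_of H f = {}"
    using plane_graph unfolding plane_graph_def by (elim conjE)
  then have "(arc_of H e - e) \<inter> arc_of H f = {}"
    using assms(1-3) by simp
  with assms(4,5) show ?thesis by blast
qed

lemma arcs_meet:
  assumes "e \<in> edges H" "f \<in> edges H" "e \<noteq> f" "p \<in> arc_of H e" "p \<in> arc_of H f"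
  shows "p \<in> e" "p \<in> f"
  using open_arc_disjoint assms by metis+

lemma closed_points_of:
  assumes "subgraph_of K H" shows "closed (points_of H K)"
proof -
  have "finite (verts K)" "finite (edges K)" "\<And>e. e \<in> edges K \<Longrightarrow> closed (arc_of H e)"
    using assms finite_verts finite_edges arc_facts(2) unfolding subgraph_of_def
    by (auto intro: finite_subset)
  then show ?thesis
    unfolding points_of_def by (intro closed_Un closed_UN finite_imp_closed) auto
qed

lemma interior_points_of:
  assumes "subgraph_of K H" shows "interior (points_of H K) = {}"
proof -
  have fin: "finite (verts K)" "finite (edges K)" "edges K \<subseteq> edges H"
    using assms finite_verts finite_edges unfolding subgraph_of_def by (auto intro: finite_subset)
  have "interior (\<Union> (insert (verts K) (arc_of H ` edges K))) = {}"
  proof (rule interior_Union_finite_empty)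
    fix X assume "X \<in> insert (verts K) (arc_of H ` edges K)"
    then show "closed X \<and> interior X = {}"
      using fin arc_facts(2,4)
      by (auto simp: finite_imp_closed empty_interior_finite)
  qed (use fin in auto)
  then show ?thesis unfolding points_of_def by simp
qed

lemma vertex_on_points:
  assumes "subgraph_of K H" "\<And>e. e \<in> edges K \<Longrightarrow> e \<subseteq> verts K" "v \<in> verts H"
  shows "v \<in> points_of H K \<longleftrightarrow> v \<in> verts K"
  using assms vertex_on_arc unfolding points_of_def subgraph_of_def by blast

lemma path_arc:
  assumes "distinct vs" "2 \<le> length vs" "path_edges vs \<subseteq> edges H"
  obtains g where "arc g" "pathstart g = hd vs" "pathfinish g = last vs"
    "path_image g = (\<Union>e\<in>path_edges vs. arc_of H e)"
proof -
  have "\<exists>g. arc g \<and> pathstart g = hd vs \<and> pathfinish g = last vs \<and>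
      path_image g = (\<Union>e\<in>path_edges vs. arc_of H e)"
    using assms
  proof (induction vs rule: path_edges.induct)
    case (1 x y zs)
    have "{x, y} \<in> edges H" using 1(4) by simp
    then obtain g where g: "arc g" "path_image g = arc_of H {x, y}" "pathstart g = x"
        "pathfinish g = y"
      by (rule edge_arc)
    show ?case
    proof (cases "zs = []")
      case True
      with g show ?thesis by auto
    next
      case False
      then have "2 \<le> length (y # zs)" by (cases zs) auto
      with 1 obtain h where h: "arc h" "pathstart h = y" "pathfinish h = last zs"
          "path_image h = (\<Union>e\<in>path_edges (y # zs). arc_of H e)"
        using False by force
      \<comment> \<open>Different edges meet only in common ends, and \<open>x\<close> is an end of
        no later edge.\<close>
      have "path_image g \<inter> path_image h \<subseteq> {y}"
      proof
        fix p assume p: "p \<in> path_image g \<inter> path_image h"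
        then obtain f where f: "f \<in> path_edges (y # zs)" "p \<in> arc_of H f" using h by auto
        have "x \<notin> f" using path_edges_subset [OF f(1)] 1(2) by auto
        moreover have "p \<in> {x, y}" "p \<in> f"
          using arcs_meet [of "{x, y}" f p] \<open>{x, y} \<in> edges H\<close> f p g 1(4) \<open>x \<notin> f\<close> by auto
        ultimately show "p \<in> {y}" by auto
      qed
      then show ?thesis
        using g h False by (intro exI [of _ "g +++ h"]) (simp add: arc_join path_image_join)
    qed
  qed auto
  with that show thesis by blast
qed

lemma path_points_meet:
  assumes "path_edges vs \<subseteq> edges H" "E \<subseteq> edges H" "path_edges vs \<inter> E = {}"
    "p \<in> (\<Union>e\<in>path_edges vs. arc_of H e)" "p \<in> (\<Union>e\<in>E. arc_of H e)"
  shows "p \<in> set vs" "p \<in> \<Union>E"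
proof -
  obtain e f where ef: "e \<in> path_edges vs" "f \<in> E" "p \<in> arc_of H e" "p \<in> arc_of H f"
    using assms(4,5) by blast
  then have "e \<noteq> f" "e \<in> edges H" "f \<in> edges H" using assms(1-3) by blast+
  with ef have "p \<in> e" "p \<in> f" using arcs_meet by metis+
  with ef path_edges_subset show "p \<in> set vs" "p \<in> \<Union>E" by blast+
qed

lemma points_of_cycle:
  assumes "is_cycle B" "subgraph_of B H"
  shows "points_of H B = (\<Union>e\<in>edges B. arc_of H e)"
proof -
  have "v \<in> (\<Union>e\<in>edges B. arc_of H e)" if v: "v \<in> verts B" for v
  proof -
    obtain e where "e \<in> edges B" "v \<in> e" using is_cycle_covered [OF assms(1) v] by blast
    moreover then have "e \<subseteq> arc_of H e"
      using assms(2) arc_facts(1) unfolding subgraph_of_def by blast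
    ultimately show ?thesis by blast
  qed
  then show ?thesis unfolding points_of_def by blast
qed

lemma cycle_arcs:
  assumes B: "is_cycle B" "subgraph_of B H" and "a \<in> verts B" "c \<in> verts B" "a \<noteq> c"
  obtains xs ys g h where "distinct (a # xs @ c # ys)" "xs \<noteq> [] \<or> ys \<noteq> []"
    "verts B = set (a # xs @ c # ys)"
    "edges B = path_edges (a # xs @ [c]) \<union> path_edges (c # ys @ [a])"
    "arc g" "pathstart g = a" "pathfinish g = c"
    "path_image g = (\<Union>e\<in>path_edges (a # xs @ [c]). arc_of H e)"
    "arc h" "pathstart h = a" "pathfinish h = c"
    "path_image h = (\<Union>e\<in>path_edges (c # ys @ [a]). arc_of H e)"
    "path_image g \<inter> path_image h = {a, c}"
    "points_of H B = path_image g \<union> path_image h"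
proof -
  obtain xs ys where xy: "distinct (a # xs @ c # ys)" "verts B = set (a # xs @ c # ys)"
    "edges B = path_edges (a # xs @ [c]) \<union> path_edges (c # ys @ [a])"
    "xs \<noteq> [] \<or> ys \<noteq> []"
    using is_cycle_split [OF B(1) assms(3-5)] .
  have sub: "path_edges (a # xs @ [c]) \<subseteq> edges H" "path_edges (c # ys @ [a]) \<subseteq> edges H"
    using B(2) xy(3) unfolding subgraph_of_def by auto
  obtain g where g: "arc g" "pathstart g = a" "pathfinish g = c"
    "path_image g = (\<Union>e\<in>path_edges (a # xs @ [c]). arc_of H e)"
    using path_arc [of "a # xs @ [c]"] xy(1) sub by auto
  obtain h where h: "arc h" "pathstart h = c" "pathfinish h = a"
    "path_image h = (\<Union>e\<in>path_edges (c # ys @ [a]). arc_of H e)"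
    using path_arc [of "c # ys @ [a]"] xy(1) sub by auto
  have sub_ac: "path_image g \<inter> path_image h \<subseteq> {a, c}"
  proof
    fix p assume p: "p \<in> path_image g \<inter> path_image h"
    have "p \<in> set (a # xs @ [c])" "p \<in> set (c # ys @ [a])"
      using path_points_meet [OF sub two_paths_disjoint [OF xy(1,4)], of p]
        path_points_meet [OF sub(2,1), of p] two_paths_disjoint [OF xy(1,4)] p g h
      by (auto simp: Int_commute)
    with xy(1) show "p \<in> {a, c}" by auto
  qed
  have "{a, c} \<subseteq> path_image g \<inter> path_image h"
    using g(2,3) h(2,3) pathstart_in_path_image [of g] pathfinish_in_path_image [of g]
      pathstart_in_path_image [of h] pathfinish_in_path_image [of h] by simp
  with sub_ac have "path_image g \<inter> path_image (reversepath h) = {a, c}"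
    by (simp add: subset_antisym)
  moreover have "points_of H B = path_image g \<union> path_image (reversepath h)"
    unfolding points_of_cycle [OF B] xy(3) g h path_image_reversepath by (rule UN_Un)
  moreover have "arc (reversepath h)" "pathstart (reversepath h) = a" "pathfinish (reversepath h) = c"
      "path_image (reversepath h) = (\<Union>e\<in>path_edges (c # ys @ [a]). arc_of H e)"
    using h by (simp_all add: arc_reversepath)
  ultimately show thesis
    using that [OF xy(1,4,2,3) g(1-4)] by blast
qed

lemma cycle_loop:
  assumes B: "is_cycle B" "subgraph_of B H"
  obtains p where "simple_path p" "pathfinish p = pathstart p" "path_image p = points_of H B"
proof -
  obtain vs where vs: "distinct vs" "3 \<le> length vs" "verts B = set vs"
    using B(1) unfolding is_cycle_def by blast
  then obtain a c ws where "vs = a # c # ws"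
    by (metis Suc_le_length_iff numeral_3_eq_3)
  with vs have "a \<in> verts B" "c \<in> verts B" "a \<noteq> c" by auto
  then obtain g h where gh: "arc g" "pathstart g = a" "pathfinish g = c"
    "arc h" "pathstart h = a" "pathfinish h = c" "path_image g \<inter> path_image h = {a, c}"
    "points_of H B = path_image g \<union> path_image h"
    using cycle_arcs [OF B] by metis
  have "simple_path (g +++ reversepath h)"
    using gh by (intro simple_path_join_loop) (auto simp: arc_reversepath)
  with gh that [of "g +++ reversepath h"] show thesis by (simp add: path_image_join)
qed

text \<open>Frontiers of components are used instead of \<open>boundary\<close> so that the property
  makes sense for any subgraph drawn with the arcs of \<open>H\<close>, in particular for the stages
  of an ear decomposition.\<close>

definition cyclic_faces :: "(complex, 'm) ugraph_scheme \<Rightarrow> bool" where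
  "cyclic_faces M \<longleftrightarrow> (\<forall>\<phi>\<in>components (- points_of H M).
     \<exists>B::complex ugraph. is_cycle B \<and> subgraph_of B M \<and> frontier \<phi> = points_of H B)"

lemma cyclic_faces_cycle:
  assumes "is_cycle M" "subgraph_of M H"
  shows "cyclic_faces (M :: complex ugraph)"
proof -
  obtain p where p: "simple_path p" "pathfinish p = pathstart p" "path_image p = points_of H M"
    using cycle_loop [OF assms] .
  then have "jordan_set (points_of H M)"
    using jordan_set_path_image by metis
  then have "frontier \<phi> = points_of H M" if "\<phi> \<in> components (- points_of H M)" for \<phi>
    using that unfolding jordan_set_def by auto
  moreover have "subgraph_of M M" unfolding subgraph_of_def by simp
  ultimately show ?thesis
    using assms unfolding cyclic_faces_def by blast
qed

lemma frontier_component_points_of: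
  assumes "subgraph_of K H" "\<phi> \<in> components (- points_of H K)"
  shows "open \<phi>" "frontier \<phi> \<subseteq> points_of H K" "\<phi> \<inter> points_of H K = {}" "connected \<phi>" "\<phi> \<noteq> {}"
proof -
  note cl = closed_points_of [OF assms(1)]
  show "open \<phi>" using cl assms(2) open_components by (metis open_Compl)
  show "frontier \<phi> \<subseteq> points_of H K"
    by (rule frontier_of_components_closed_complement [OF cl assms(2)])
  show "\<phi> \<inter> points_of H K = {}" using in_components_subset [OF assms(2)] by blast
  show "connected \<phi>" "\<phi> \<noteq> {}"
    using assms(2) in_components_connected in_components_nonempty by blast+
qed

lemma points_of_two_paths:
  assumes "distinct (a # xs @ c # ys)" "xs \<noteq> [] \<or> ys \<noteq> []"
    "set (a # xs @ c # ys) \<subseteq> verts M"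
    "path_edges (a # xs @ [c]) \<subseteq> edges M" "path_edges (c # ys @ [a]) \<subseteq> edges M"
    and M: "subgraph_of M H"
  obtains B :: "complex ugraph" where "is_cycle B" "subgraph_of B M"
    "points_of H B = (\<Union>e\<in>path_edges (a # xs @ [c]). arc_of H e) \<union>
       (\<Union>e\<in>path_edges (c # ys @ [a]). arc_of H e)"
proof -
  define B where "B = \<lparr>verts = set (a # xs @ c # ys),
    edges = path_edges (a # xs @ [c]) \<union> path_edges (c # ys @ [a])\<rparr>"
  have cyc: "is_cycle B" unfolding B_def by (rule is_cycle_two_paths [OF assms(1,2)])
  moreover have sub: "subgraph_of B M"
    using assms(3-5) unfolding B_def subgraph_of_def by simp
  moreover have "subgraph_of B H" using sub M unfolding subgraph_of_def by blast
  then have "points_of H B = (\<Union>e\<in>edges B. arc_of H e)"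
    by (rule points_of_cycle [OF cyc])
  then have "points_of H B = (\<Union>e\<in>path_edges (a # xs @ [c]). arc_of H e) \<union>
       (\<Union>e\<in>path_edges (c # ys @ [a]). arc_of H e)"
    by (simp add: B_def UN_Un)
  ultimately show thesis using that by blast
qed

text \<open>A face \<open>F\<close> of \<open>M\<close> that misses the ear stays a face. Otherwise
  the open ear lies in \<open>F\<close>, so its ends lie on the boundary cycle of \<open>F\<close>,
  and that cycle together with the ear is a theta graph having \<open>\<phi>\<close> as a face. Each
  of the three cycles of the theta graph is a subgraph of \<open>M'\<close>.\<close>

lemma cyclic_faces_ear:
  fixes M :: "complex ugraph"
  assumes M: "subgraph_of M H" "\<And>e. e \<in> edges M \<Longrightarrow> e \<subseteq> verts M" "cyclic_faces M"
    and ac: "a \<in> verts M" "c \<in> verts M"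
    and zs: "distinct (a # zs @ [c])" "set zs \<inter> verts M = {}" "set zs \<subseteq> verts H"
      "path_edges (a # zs @ [c]) \<subseteq> edges H" "path_edges (a # zs @ [c]) \<inter> edges M = {}"
    and M': "M' = \<lparr>verts = verts M \<union> set zs, edges = edges M \<union> path_edges (a # zs @ [c])\<rparr>"
  shows "cyclic_faces M'"
  unfolding cyclic_faces_def
proof
  define P where "P = (\<Union>e\<in>path_edges (a # zs @ [c]). arc_of H e)"
  have sub: "subgraph_of M' H"
    using M(1) zs unfolding M' subgraph_of_def by simp
  have sub': "subgraph_of B M'" if "subgraph_of B M" for B :: "complex ugraph"
    using that unfolding M' subgraph_of_def by auto
  have "set zs \<subseteq> P"
  proof
    fix z assume "z \<in> set zs"
    then obtain e where "e \<in> path_edges (a # zs @ [c])" "z \<in> e"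
      using path_edges_cover [of "a # zs @ [c]" z] by auto
    then show "z \<in> P" using zs(4) arc_facts(1) unfolding P_def by blast
  qed
  then have pM': "points_of H M' = points_of H M \<union> P"
    unfolding points_of_def M' P_def by auto
  obtain k where k: "arc k" "pathstart k = a" "pathfinish k = c" "path_image k = P"
    using path_arc [of "a # zs @ [c]"] zs(1,4) unfolding P_def by auto
  have acP: "a \<in> P" "c \<in> P"
    using k pathstart_in_path_image [of k] pathfinish_in_path_image [of k] by simp_all
  have PM: "P \<inter> points_of H M \<subseteq> {a, c}"
  proof
    fix p assume p: "p \<in> P \<inter> points_of H M"
    have "p \<in> set (a # zs @ [c]) \<and> p \<in> verts M"
    proof (cases "p \<in> verts M")
      case True
      then have "p \<in> verts H" using M(1) unfolding subgraph_of_def by blast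
      obtain e where e: "e \<in> path_edges (a # zs @ [c])" "p \<in> arc_of H e"
        using p unfolding P_def by blast
      then have "p \<in> e" using vertex_on_arc [OF \<open>p \<in> verts H\<close>] zs(4) by blast
      with path_edges_subset [OF e(1)] True show ?thesis by blast
    next
      case False
      then have "p \<in> (\<Union>e\<in>edges M. arc_of H e)"
        using p unfolding points_of_def by blast
      moreover have "edges M \<subseteq> edges H" using M(1) unfolding subgraph_of_def by blast
      ultimately have "p \<in> \<Union>(edges M)"
        using path_points_meet(2) [OF zs(4) _ zs(5)] p unfolding P_def by blast
      with M(2) False show ?thesis by blast
    qed
    with zs(2) show "p \<in> {a, c}" by auto
  qed
  fix \<phi> assume \<phi>: "\<phi> \<in> components (- points_of H M')"
  note \<phi>' = frontier_component_points_of [OF sub \<phi>]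
  obtain F where F: "F \<in> components (- points_of H M)" "\<phi> \<subseteq> F"
    by (rule component_sub_Compl [OF \<phi>, of "points_of H M"]) (use pM' in auto)
  note F' = frontier_component_points_of [OF M(1) F(1)]
  obtain B :: "complex ugraph" where B: "is_cycle B" "subgraph_of B M" "frontier F = points_of H B"
    using M(3) F(1) unfolding cyclic_faces_def by blast
  show "\<exists>B::complex ugraph. is_cycle B \<and> subgraph_of B M' \<and> frontier \<phi> = points_of H B"
  proof (cases "F \<inter> P = {}")
    case True
    then have "F \<subseteq> - points_of H M'" using F'(3) pM' by blast
    then have "F \<subseteq> \<phi>"
      using components_maximal [OF \<phi> F'(4)] F(2) \<phi>'(5) by blast
    with F(2) have "F = \<phi>" by blast
    with B sub' show ?thesis by blast
  next
    case False
    have ends: "P - {a, c} \<noteq> {}" "connected (P - {a, c})" "connected P"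
      using nonempty_simple_path_endless [of k] connected_simple_path_endless [of k]
        connected_arc_image [of k] k arc_imp_simple_path by auto
    have "a \<in> points_of H M" "c \<in> points_of H M"
      using ac unfolding points_of_def by blast+
    then have "F \<inter> (P - {a, c}) \<noteq> {}" using False F'(3) by blast
    then have "P - {a, c} \<subseteq> F"
      using components_maximal [OF F(1) ends(2)] PM by blast
    then have "P \<subseteq> closure F"
      using connected_subset_closure_Diff [OF ends(3) _ ends(1)] closure_mono
      by (meson finite.emptyI finite_insert subset_trans)
    then have "a \<in> closure F" "c \<in> closure F" using acP by blast+
    then have "a \<in> frontier F" "c \<in> frontier F"
      using \<open>a \<in> points_of H M\<close> \<open>c \<in> points_of H M\<close> F'(1,3)
      by (auto simp: frontier_def interior_open)
    have subBH: "subgraph_of B H" using B(2) M(1) unfolding subgraph_of_def by blast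
    have acH: "a \<in> verts H" "c \<in> verts H" using ac M(1) unfolding subgraph_of_def by blast+
    have acB: "a \<in> verts B" "c \<in> verts B"
      using \<open>a \<in> frontier F\<close> \<open>c \<in> frontier F\<close> unfolding B(3)
      using vertex_on_points [OF subBH is_cycle_edge_subset [OF B(1)]] acH by blast+
    have "a \<noteq> c" using zs(1) by auto
    obtain xs ys g h where gh: "distinct (a # xs @ c # ys)" "xs \<noteq> [] \<or> ys \<noteq> []"
        "verts B = set (a # xs @ c # ys)"
        "edges B = path_edges (a # xs @ [c]) \<union> path_edges (c # ys @ [a])"
        "arc g" "pathstart g = a" "pathfinish g = c"
        "path_image g = (\<Union>e\<in>path_edges (a # xs @ [c]). arc_of H e)"
        "arc h" "pathstart h = a" "pathfinish h = c"
        "path_image h = (\<Union>e\<in>path_edges (c # ys @ [a]). arc_of H e)"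
        "path_image g \<inter> path_image h = {a, c}"
        "points_of H B = path_image g \<union> path_image h"
      using cycle_arcs [OF B(1) subBH acB \<open>a \<noteq> c\<close>] .
    have BM: "points_of H B \<subseteq> points_of H M"
      using B(2) unfolding points_of_def subgraph_of_def by blast
    have meet: "path_image g \<inter> path_image k = {a, c}" "path_image h \<inter> path_image k = {a, c}"
      using PM BM gh(13,14) acP unfolding k(4) by blast+
    \<comment> \<open>The frontier of \<open>\<phi>\<close> lies in the closure of \<open>F\<close>,
      where \<open>M'\<close> has no points besides the boundary of \<open>F\<close> and the
      ear.\<close>
    have "\<phi> \<in> components (- (path_image g \<union> path_image h \<union> path_image k))"
    proof (rule componentsI_frontier)
      show "\<phi> \<inter> (path_image g \<union> path_image h \<union> path_image k) = {}"
        using \<phi>'(3) BM gh(14) pM' k(4) by blast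
      have "frontier \<phi> \<subseteq> closure F"
        using F(2) closure_mono [of \<phi> F] unfolding frontier_def by blast
      also have "closure F = F \<union> frontier F"
        by (metis F'(1) closure_Un_frontier)
      finally show "frontier \<phi> \<subseteq> path_image g \<union> path_image h \<union> path_image k"
        using \<phi>'(2) F'(3) gh(14) unfolding pM' k(4) B(3) by blast
    qed (use \<phi>' in auto)
    then consider "frontier \<phi> = path_image g \<union> path_image h"
      | "frontier \<phi> = path_image h \<union> path_image k" | "frontier \<phi> = path_image g \<union> path_image k"
      using theta_arcs [OF gh(5,9) k(1) gh(6,7,10,11) k(2,3) gh(13) meet] by blast
    then show ?thesis
    proof cases
      case 1
      with gh(14) B sub' show ?thesis by blast
    next
      case 2
      have nd: "distinct (a # zs @ c # ys)"
        using gh(1,3) zs(1,2) B(2) unfolding subgraph_of_def by auto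
      \<comment> \<open>Were both paths single edges, the ear would be an edge of \<open>M\<close>,
        but its edges are new.\<close>
      have ne: "zs \<noteq> [] \<or> ys \<noteq> []"
      proof (rule ccontr)
        assume "\<not> ?thesis"
        then have "{a, c} \<in> edges B" "{a, c} \<in> path_edges (a # zs @ [c])"
          unfolding gh(4) by (auto simp: insert_commute)
        with zs(5) B(2) show False unfolding subgraph_of_def by blast
      qed
      have "set (a # zs @ c # ys) \<subseteq> verts M'" "path_edges (c # ys @ [a]) \<subseteq> edges M'"
        "path_edges (a # zs @ [c]) \<subseteq> edges M'"
        using B(2) gh(3,4) unfolding M' subgraph_of_def by auto
      then obtain B' :: "complex ugraph" where "is_cycle B'" "subgraph_of B' M'"
          "points_of H B' = (\<Union>e\<in>path_edges (a # zs @ [c]). arc_of H e) \<union>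
            (\<Union>e\<in>path_edges (c # ys @ [a]). arc_of H e)"
        using points_of_two_paths [OF nd ne _ _ _ sub] by blast
      with 2 show ?thesis
        unfolding gh(12) k(4) P_def by (metis Un_commute)
    next
      case 3
      have pr: "path_edges (c # rev zs @ [a]) = path_edges (a # zs @ [c])"
        using path_edges_rev [of "a # zs @ [c]"] by simp
      have nd: "distinct (c # rev zs @ a # xs)"
        using gh(1,3) zs(1,2) B(2) unfolding subgraph_of_def by auto
      have ne: "rev zs \<noteq> [] \<or> xs \<noteq> []"
      proof (rule ccontr)
        assume "\<not> ?thesis"
        then have "{a, c} \<in> edges B" "{a, c} \<in> path_edges (a # zs @ [c])"
          unfolding gh(4) by auto
        with zs(5) B(2) show False unfolding subgraph_of_def by blast
      qed
      have "set (c # rev zs @ a # xs) \<subseteq> verts M'" "path_edges (a # xs @ [c]) \<subseteq> edges M'"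
        "path_edges (c # rev zs @ [a]) \<subseteq> edges M'"
        using B(2) gh(3,4) unfolding pr unfolding M' subgraph_of_def by auto
      then obtain B' :: "complex ugraph" where "is_cycle B'" "subgraph_of B' M'"
          "points_of H B' = (\<Union>e\<in>path_edges (c # rev zs @ [a]). arc_of H e) \<union>
            (\<Union>e\<in>path_edges (a # xs @ [c]). arc_of H e)"
        using points_of_two_paths [OF nd ne _ _ _ sub] by blast
      with 3 show ?thesis
        unfolding gh(8) k(4) P_def pr by (metis Un_commute)
    qed
  qed
qed

text \<open>The ear decomposition is replaced by extremality: a subgraph with cyclic faces of
  maximal size must be \<open>K\<close>, since an ear would enlarge it. The two vertices in
  \<open>good\<close> are those required by \<open>ear_exists\<close>.\<close>

lemma cyclic_faces_two_connected:
  assumes K: "subgraph_of K H" "simple_graph K" "two_connected K"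
  shows "cyclic_faces K"
proof -
  have finK: "finite (verts K)" "finite (edges K)"
    using K(1) finite_verts finite_edges unfolding subgraph_of_def by (auto intro: finite_subset)
  have KH: "verts K \<subseteq> verts H" "edges K \<subseteq> edges H"
    using K(1) unfolding subgraph_of_def by blast+
  define good where "good M \<longleftrightarrow> subgraph_of M K \<and> (\<forall>e\<in>edges M. e \<subseteq> verts M) \<and>
    (\<exists>u\<in>verts M. \<exists>v\<in>verts M. u \<noteq> v) \<and> cyclic_faces M" for M :: "complex ugraph"
  have "\<exists>M. good M"
  proof -
    have "3 \<le> card (verts K)" using K(3) unfolding two_connected_def by blast
    then obtain u w where uw: "u \<in> verts K" "w \<in> verts K" "u \<noteq> w"
      using finK(1) by (metis One_nat_def card_le_Suc0_iff_eq not_numeral_le_zero numeral_le_one_iff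
          order_trans semiring_norm(70))
    have "(u, w) \<in> {(x, y). {x, y} \<in> edges K}\<^sup>*"
      using K(3) uw unfolding two_connected_def connected_graph_def by blast
    then obtain v where uv: "{u, v} \<in> edges K"
      using uw(3) by (auto elim: converse_rtranclE)
    have "u \<noteq> v"
    proof -
      have "{u, v} \<in> edges H" using uv KH(2) by (rule subsetD [rotated])
      then obtain x y where "x \<noteq> y" "{u, v} = {x, y}" by (rule edge_ends)
      then show ?thesis by auto
    qed
    have vK: "v \<in> verts K" using simple_edge_subset [OF K(2) uv] by simp
    \<comment> \<open>A single edge already satisfies the hypotheses of \<open>ear_exists\<close>;
      an ear attached to it closes the first cycle.\<close>
    define M :: "complex ugraph" where "M = \<lparr>verts = {u, v}, edges = {{u, v}}\<rparr>"
    have MK: "subgraph_of M K" using uw vK uv unfolding M_def subgraph_of_def by simp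
    have "verts M \<noteq> verts K"
    proof
      assume "verts M = verts K"
      then have "card (verts K) = 2" using \<open>u \<noteq> v\<close> by (metis M_def card_2_iff ugraph.select_convs(1))
      with \<open>3 \<le> card (verts K)\<close> show False by simp
    qed
    note neq = disjI1 [OF this]
    have Mf: "\<And>e. e \<in> edges M \<Longrightarrow> e \<subseteq> verts M" "u \<in> verts M" "v \<in> verts M"
      by (simp_all add: M_def)
    obtain a zs c where z: "a \<in> verts M" "c \<in> verts M" "distinct (a # zs @ [c])"
        "set zs \<inter> verts M = {}" "set zs \<subseteq> verts K"
        "path_edges (a # zs @ [c]) \<subseteq> edges K" "path_edges (a # zs @ [c]) \<inter> edges M = {}"
      by (rule ear_exists [OF K(2,3) MK Mf \<open>u \<noteq> v\<close> neq])
    have "a \<noteq> c" using z(3) by auto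
    then have ac: "{a, c} = {u, v}" using z(1,2) unfolding M_def by auto
    have ne: "zs \<noteq> [] \<or> [] \<noteq> []" using z(7) ac unfolding M_def by auto
    have d: "distinct (a # zs @ c # [])" using z(3) by simp
    have s: "set (a # zs @ c # []) \<subseteq> verts K" "path_edges (c # [] @ [a]) \<subseteq> edges K"
      using z(1,2,5) MK ac uv unfolding subgraph_of_def by (auto simp: insert_commute)
    obtain B :: "complex ugraph" where B: "is_cycle B" "subgraph_of B K"
      using points_of_two_paths [OF d ne s(1) z(6) s(2) K(1)] by metis
    have BH: "subgraph_of B H" using B(2) KH unfolding subgraph_of_def by blast
    obtain vs where vs: "distinct vs" "3 \<le> length vs" "verts B = set vs"
      using B(1) unfolding is_cycle_def by blast
    then obtain p q ws where "vs = p # q # ws"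
      by (metis Suc_le_length_iff numeral_3_eq_3)
    with vs have "p \<in> verts B" "q \<in> verts B" "p \<noteq> q" by auto
    then have "good B"
      unfolding good_def
      using B is_cycle_edge_subset [OF B(1)] cyclic_faces_cycle [OF B(1) BH] by blast
    then show ?thesis by blast
  qed
  define size where "size M = card (verts M) + card (edges M)" for M :: "complex ugraph"
  have "size M \<le> card (verts K) + card (edges K)" if "good M" for M
    using that finK unfolding good_def subgraph_of_def size_def
    by (intro add_mono card_mono) auto
  then have "\<forall>M. good M \<longrightarrow> size M < Suc (card (verts K) + card (edges K))"
    by (simp add: le_imp_less_Suc)
  with \<open>\<exists>M. good M\<close> obtain M where M: "good M" "\<And>N. good N \<Longrightarrow> size N \<le> size M"
    using ex_has_greatest_nat [of good _ size] by metis
  have MK: "subgraph_of M K" and Me: "\<And>e. e \<in> edges M \<Longrightarrow> e \<subseteq> verts M"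
    and Mc: "cyclic_faces M"
    using M(1) unfolding good_def by blast+
  obtain u v where uv: "u \<in> verts M" "v \<in> verts M" "u \<noteq> v"
    using M(1) unfolding good_def by blast
  have MH: "subgraph_of M H" using MK KH unfolding subgraph_of_def by blast
  have eq: "verts M = verts K \<and> edges M = edges K"
  proof (rule ccontr)
    assume "\<not> ?thesis"
    then have neq: "verts M \<noteq> verts K \<or> edges M \<noteq> edges K" by blast
    obtain a zs c where z: "a \<in> verts M" "c \<in> verts M" "distinct (a # zs @ [c])"
        "set zs \<inter> verts M = {}" "set zs \<subseteq> verts K"
        "path_edges (a # zs @ [c]) \<subseteq> edges K" "path_edges (a # zs @ [c]) \<inter> edges M = {}"
      by (rule ear_exists [OF K(2,3) MK Me uv neq])
    define N where "N = \<lparr>verts = verts M \<union> set zs, edges = edges M \<union> path_edges (a # zs @ [c])\<rparr>"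
    have "set zs \<subseteq> verts H" "path_edges (a # zs @ [c]) \<subseteq> edges H" using z(5,6) KH by blast+
    then have "cyclic_faces N"
      using cyclic_faces_ear [OF MH Me Mc z(1-4) _ _ z(7) N_def] by blast
    moreover have "subgraph_of N K" using MK z(5,6) unfolding subgraph_of_def N_def by simp
    moreover have "e \<subseteq> verts N" if "e \<in> edges N" for e
      using that Me path_edges_subset [of e "a # zs @ [c]"] z(1,2) unfolding N_def by auto
    moreover have "u \<in> verts N" "v \<in> verts N" using uv unfolding N_def by simp_all
    ultimately have "good N" unfolding good_def using uv(3) by blast
    moreover have "size M < size N"
    proof -
      have fin: "finite (verts N)" "finite (edges N)"
        using \<open>subgraph_of N K\<close> finK unfolding subgraph_of_def by (auto intro: finite_subset)
      have "path_edges (a # zs @ [c]) \<noteq> {}" by (cases zs) auto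
      then have "edges M \<subset> edges N" using z(7) unfolding N_def by auto
      then have "card (edges M) < card (edges N)" using fin by (simp add: psubset_card_mono)
      moreover have "card (verts M) \<le> card (verts N)"
        using fin by (intro card_mono) (auto simp: N_def)
      ultimately show ?thesis unfolding size_def by simp
    qed
    ultimately show False using M(2) by (meson not_le)
  qed
  then have "points_of H M = points_of H K" unfolding points_of_def by simp
  with Mc eq show ?thesis unfolding cyclic_faces_def subgraph_of_def by metis
qed

section \<open>Finiteness of the set of faces, and boundaries of faces\<close>

lemma finite_components_points_of:
  assumes "subgraph_of K H" "cyclic_faces K"
  shows "finite (components (- points_of H K))"
proof -
  have finK: "finite (verts K)" "finite (edges K)"
    using assms(1) finite_verts finite_edges unfolding subgraph_of_def by (auto intro: finite_subset)
  define \<B> where "\<B> = {B::complex ugraph. is_cycle B \<and> subgraph_of B K}"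
  have "\<B> \<subseteq> (\<lambda>(V, E). \<lparr>verts = V, edges = E\<rparr>) ` (Pow (verts K) \<times> Pow (edges K))"
  proof
    fix B assume "B \<in> \<B>"
    then have "(verts B, edges B) \<in> Pow (verts K) \<times> Pow (edges K)"
      unfolding \<B>_def subgraph_of_def by auto
    then show "B \<in> (\<lambda>(V, E). \<lparr>verts = V, edges = E\<rparr>) ` (Pow (verts K) \<times> Pow (edges K))"
      by (rule image_eqI [rotated]) simp
  qed
  then have "finite \<B>" by (rule finite_subset) (use finK in simp)
  moreover have "finite (components (- points_of H B))" if "B \<in> \<B>" for B
  proof -
    have "is_cycle B" "subgraph_of B H"
      using that assms(1) unfolding \<B>_def subgraph_of_def by blast+
    then obtain p where "simple_path p" "pathfinish p = pathstart p" "path_image p = points_of H B"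
      by (rule cycle_loop)
    then show ?thesis using Jordan_components(1) by (metis finite.emptyI finite_insert)
  qed
  \<comment> \<open>A face is one of the two sides of its own boundary cycle, and there are only
    finitely many cycles.\<close>
  moreover have "components (- points_of H K) \<subseteq> (\<Union>B\<in>\<B>. components (- points_of H B))"
  proof
    fix \<phi> assume \<phi>: "\<phi> \<in> components (- points_of H K)"
    then obtain B where B: "B \<in> \<B>" "frontier \<phi> = points_of H B"
      using assms(2) unfolding cyclic_faces_def \<B>_def by blast
    then have "points_of H B \<subseteq> points_of H K"
      unfolding \<B>_def points_of_def subgraph_of_def by blast
    with frontier_component_points_of [OF assms(1) \<phi>] B(2)
    have "\<phi> \<in> components (- points_of H B)"
      by (intro componentsI_frontier) auto
    with B show "\<phi> \<in> (\<Union>B\<in>\<B>. components (- points_of H B))" by blast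
  qed
  ultimately show ?thesis by (meson finite_UN_I finite_subset)
qed

text \<open>The drawing has empty interior, so the faces together are dense; as there are finitely
  many of them, the union of their closures is closed.\<close>

lemma in_closure_face:
  assumes "subgraph_of K H" "cyclic_faces K"
  obtains \<phi> where "\<phi> \<in> components (- points_of H K)" "p \<in> closure \<phi>"
proof -
  have "closure (- points_of H K) = UNIV"
    using interior_points_of [OF assms(1)] by (simp add: closure_complement)
  moreover have "closure (- points_of H K) \<subseteq> (\<Union>\<phi>\<in>components (- points_of H K). closure \<phi>)"
  proof (rule closure_minimal)
    show "- points_of H K \<subseteq> (\<Union>\<phi>\<in>components (- points_of H K). closure \<phi>)"
    proof
      fix q assume "q \<in> - points_of H K"
      then have "q \<in> \<Union>(components (- points_of H K))" by simp
      then show "q \<in> (\<Union>\<phi>\<in>components (- points_of H K). closure \<phi>)"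
        using closure_subset by blast
    qed
    show "closed (\<Union>\<phi>\<in>components (- points_of H K). closure \<phi>)"
      using finite_components_points_of [OF assms] by (intro closed_UN) auto
  qed
  ultimately have "(\<Union>\<phi>\<in>components (- points_of H K). closure \<phi>) = UNIV" by blast
  then have "p \<in> (\<Union>\<phi>\<in>components (- points_of H K). closure \<phi>)" by simp
  with that show thesis by blast
qed

text \<open>The cycle can be read off from its point set: a vertex on it belongs to the cycle, and
  an edge drawn inside it is one of its edges, because an inner point of an arc lies on no other
  arc.\<close>

lemma face_boundary_cycle:
  assumes "two_connected H" "F \<in> faces H"
  shows "is_cycle (boundary H F)" "subgraph_of (boundary H F) H"
    "frontier F = points_of H (boundary H F)"
proof -
  have "subgraph_of H H" unfolding subgraph_of_def by simp
  then obtain B :: "complex ugraph" where B: "is_cycle B" "subgraph_of B H" "frontier F = points_of H B"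
    using cyclic_faces_two_connected [OF _ simple assms(1)] assms(2)
    unfolding cyclic_faces_def faces_def by blast
  have "{v \<in> verts H. v \<in> points_of H B} = verts B"
    using vertex_on_points [OF B(2) is_cycle_edge_subset [OF B(1)]] B(2)
    unfolding subgraph_of_def by blast
  moreover have "{e \<in> edges H. arc_of H e \<subseteq> points_of H B} = edges B"
  proof
    show "edges B \<subseteq> {e \<in> edges H. arc_of H e \<subseteq> points_of H B}"
      using B(2) unfolding subgraph_of_def points_of_def by blast
    show "{e \<in> edges H. arc_of H e \<subseteq> points_of H B} \<subseteq> edges B"
    proof (rule subsetI, rule ccontr)
      fix e assume "e \<in> {e \<in> edges H. arc_of H e \<subseteq> points_of H B}" and n: "e \<notin> edges B"
      then have e: "e \<in> edges H" "arc_of H e \<subseteq> points_of H B" by auto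
      obtain p where p: "p \<in> arc_of H e" "p \<notin> e" using arc_facts(6) [OF e(1)] by blast
      then obtain f where "f \<in> edges B" "p \<in> arc_of H f"
        using e(2) unfolding points_of_cycle [OF B(1,2)] by blast
      moreover then have "f \<in> edges H" "f \<noteq> e" using B(2) n unfolding subgraph_of_def by blast+
      ultimately show False using open_arc_disjoint [OF e(1) _ _ p] by metis
    qed
  qed
  ultimately have "boundary H F = B"
    unfolding boundary_def B(3) by simp
  with B show "is_cycle (boundary H F)" "subgraph_of (boundary H F) H"
    "frontier F = points_of H (boundary H F)" by simp_all
qed

end


section \<open>Uncrossed chordless cycles of the auxiliary graph\<close>

locale uncrossed_cycle =
  fixes G H :: plane_drawing
    and nabla :: "complex set \<Rightarrow> complex"
    and C :: "complex ugraph"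
  assumes plane_G: "plane_graph G" and two_conn: "two_connected G"
    and aux: "auxiliary_graph G nabla H"
    and cycle: "cycle_of C H" and chordless: "chordless C H"
    and uncrossed: "\<And>F. F \<in> large_faces G \<Longrightarrow> \<not> crosses G nabla F C"
begin

sublocale G: plane G
  by unfold_locales (rule plane_G)

sublocale H: plane H
  by unfold_locales (use aux in \<open>simp add: auxiliary_graph_def\<close>)

abbreviation "S \<equiv> verts C \<inter> verts G"

definition K :: "complex ugraph" where
  "K = \<lparr>verts = verts G \<union> verts C, edges = edges G \<union> edges C\<rparr>"

section \<open>New vertices, faces of \<open>G\<close> and spokes\<close>

lemma nabla_in: "F \<in> large_faces G \<Longrightarrow> nabla F \<in> F"
  using aux unfolding auxiliary_graph_def by simp

lemma verts_H: "verts H = verts G \<union> nabla ` large_faces G"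
  using aux unfolding auxiliary_graph_def by simp

lemma edges_H: "edges H = edges G \<union>
    {{nabla F, v} | F v. F \<in> large_faces G \<and> v \<in> verts (boundary G F)}"
  using aux unfolding auxiliary_graph_def by simp

lemma arcs_agree: "e \<in> edges G \<Longrightarrow> arc_of H e = arc_of G e"
  using aux unfolding auxiliary_graph_def by simp

lemma C_cycle: "is_cycle C" and CH: "subgraph_of C H"
  using cycle unfolding cycle_of_def by auto

lemma GH: "subgraph_of G H"
  unfolding subgraph_of_def verts_H edges_H by blast

lemma KH: "subgraph_of K H"
  using GH CH unfolding subgraph_of_def K_def by simp

lemma simple_K: "simple_graph K"
proof -
  have "\<exists>u\<in>verts K. \<exists>v\<in>verts K. u \<noteq> v \<and> e = {u, v}" if e: "e \<in> edges K" for e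
  proof -
    have "e \<in> edges H" using KH e unfolding subgraph_of_def by blast
    then obtain u v where uv: "u \<noteq> v" "e = {u, v}" by (rule H.edge_ends)
    have "e \<subseteq> verts K"
      using e G.edge_subset [of e] is_cycle_edge_subset [OF C_cycle, of e]
      unfolding K_def by auto
    with uv show ?thesis by blast
  qed
  moreover have "finite (verts K)"
    using KH H.finite_verts unfolding subgraph_of_def by (auto intro: finite_subset)
  ultimately show ?thesis unfolding simple_graph_def by blast
qed

lemma points_sub_G:
  assumes "subgraph_of B G" shows "points_of H B = points_of G B"
proof -
  have "arc_of H e = arc_of G e" if "e \<in> edges B" for e
    using assms that arcs_agree unfolding subgraph_of_def by blast
  then show ?thesis unfolding points_of_def by simp
qed

lemma points_G: "points_of H G = points_of G G"
  using arcs_agree unfolding points_of_def by simp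

lemma large_face: "F \<in> large_faces G \<Longrightarrow> F \<in> components (- points_of H G)"
  unfolding large_faces_def faces_def points_G by blast

lemma face_of_G:
  assumes "F \<in> components (- points_of H G)"
  shows "open F" "connected F" "F \<inter> points_of H G = {}" "v \<in> verts G \<Longrightarrow> v \<notin> F"
    "is_cycle (boundary G F)" "subgraph_of (boundary G F) G"
    "frontier F = points_of H (boundary G F)"
proof -
  show "open F" "connected F" "F \<inter> points_of H G = {}"
    using H.frontier_component_points_of [OF GH assms] by blast+
  then show "v \<in> verts G \<Longrightarrow> v \<notin> F" unfolding points_of_def by blast
  have "F \<in> faces G" using assms unfolding faces_def points_G by blast
  from G.face_boundary_cycle [OF two_conn this] show "is_cycle (boundary G F)"
    "subgraph_of (boundary G F) G" "frontier F = points_of H (boundary G F)"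
    using points_sub_G by auto
qed

lemma nabla_not_G: "F \<in> large_faces G \<Longrightarrow> nabla F \<notin> verts G"
  using face_of_G(4) [OF large_face] nabla_in by blast

text \<open>The face \<open>F'\<close> is an open neighbourhood of its new vertex, so it meets every
  set whose closure contains that vertex.\<close>

lemma face_unique:
  assumes "F \<in> components (- points_of H G)" "F' \<in> large_faces G" "nabla F' \<in> closure F"
  shows "F = F'"
proof -
  have "F' \<inter> F \<noteq> {}"
    using open_Int_closure_eq_empty [OF face_of_G(1) [OF large_face [OF assms(2)]], of F]
      assms(3) nabla_in [OF assms(2)] by blast
  then show ?thesis
    using components_nonoverlap [OF assms(1) large_face [OF assms(2)]] by blast
qed

lemma nabla_inj:
  assumes "F \<in> large_faces G" "F' \<in> large_faces G" "nabla F' = nabla F"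
  shows "F' = F"
  using face_unique [OF large_face [OF assms(1)] assms(2)] nabla_in [OF assms(1)] assms(3)
    closure_subset by auto

lemma boundary_sub_G: "v \<in> verts (boundary G F) \<Longrightarrow> v \<in> verts G"
  unfolding boundary_def by simp

lemma nabla_edge:
  assumes "F \<in> large_faces G" "{nabla F, v} \<in> edges H"
  shows "v \<in> verts (boundary G F)"
proof -
  have "{nabla F, v} \<notin> edges G"
    using G.edge_subset [of "{nabla F, v}"] nabla_not_G [OF assms(1)] by auto
  then obtain F' v' where F': "F' \<in> large_faces G" "v' \<in> verts (boundary G F')"
      "{nabla F, v} = {nabla F', v'}"
    using assms(2) unfolding edges_H by blast
  have "nabla F \<noteq> v'" using nabla_not_G [OF assms(1)] boundary_sub_G [OF F'(2)] by metis
  then have "nabla F = nabla F'" "v = v'" using F'(3) by (auto simp: doubleton_eq_iff)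
  then show ?thesis using nabla_inj [OF assms(1) F'(1)] F'(2) by simp
qed

lemma edge_cases:
  assumes "e \<in> edges H"
  obtains "e \<in> edges G"
  | F v where "F \<in> large_faces G" "v \<in> verts (boundary G F)" "e = {nabla F, v}" "e \<notin> edges G"
  using assms unfolding edges_H by blast

text \<open>Without its end \<open>v\<close> the arc is still connected, contains
  \<open>nabla F\<close> and, by planarity of \<open>H\<close>, avoids the drawing of
  \<open>G\<close>; so it stays in the component \<open>F\<close>.\<close>

lemma spoke_in_face:
  assumes F: "F \<in> large_faces G" and e: "{nabla F, v} \<in> edges H"
  shows "arc_of H {nabla F, v} \<subseteq> insert v F"
proof -
  let ?e = "{nabla F, v}"
  let ?A = "arc_of H ?e"
  note a = H.arc_facts [OF e]
  have nv: "nabla F \<noteq> v"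
    using nabla_not_G [OF F] boundary_sub_G [OF nabla_edge [OF F e]] by metis
  have notG: "?e \<notin> edges G" using G.edge_subset [of ?e] nabla_not_G [OF F] by auto
  obtain g where "arc g" "path_image g = ?A" using H.edge_arc [OF e] by metis
  then have "connected ?A" using connected_arc_image by metis
  then have cl: "?A \<subseteq> closure (?A - ?e)"
    by (rule connected_subset_closure_Diff [OF _ _ a(6)]) simp
  \<comment> \<open>The arc without \<open>v\<close> lies between the open arc and its closure, and
    so inherits connectedness.\<close>
  have "?A - ?e \<subseteq> ?A - {v}" "?A - {v} \<subseteq> closure (?A - ?e)"
    using cl by blast+
  with a(5) have "connected (?A - {v})"
    by (rule connected_intermediate_closure)
  moreover have "(?A - {v}) \<inter> points_of H G = {}"
  proof -
    have "p \<notin> points_of H G" if p: "p \<in> ?A" "p \<noteq> v" for p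
    proof (cases "p = nabla F")
      case True
      then show ?thesis using nabla_in [OF F] face_of_G(3) [OF large_face [OF F]] by blast
    next
      case False
      with p have pe: "p \<notin> ?e" by simp
      have "p \<notin> verts G"
        using H.vertex_on_arc [of p ?e] e p(1) pe verts_H by blast
      moreover have "p \<notin> arc_of H f" if "f \<in> edges G" for f
        using H.open_arc_disjoint [OF e _ _ p(1) pe, of f] that notG edges_H by blast
      ultimately show ?thesis unfolding points_of_def by blast
    qed
    then show ?thesis by blast
  qed
  moreover have "nabla F \<in> F \<inter> (?A - {v})"
    using nabla_in [OF F] a(1) nv by auto
  ultimately have "?A - {v} \<subseteq> F"
    using components_maximal [OF large_face [OF F]] by blast
  then show ?thesis by blast
qed

section \<open>The graph \<open>K\<close>, the cycle \<open>C\<close> and its two sides\<close>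

lemma C_edge_in: "e \<in> edges C \<Longrightarrow> e \<in> edges H"
  using CH unfolding subgraph_of_def by blast

lemma C_edge_verts: "e \<in> edges C \<Longrightarrow> e \<subseteq> verts C"
  by (rule is_cycle_edge_subset [OF C_cycle])

lemma C_induced: "e \<in> edges H \<Longrightarrow> e \<subseteq> verts C \<Longrightarrow> e \<in> edges C"
  using chordless unfolding chordless_def by blast

lemma new_vertex:
  assumes "v \<in> verts K" "v \<notin> verts G"
  obtains F where "F \<in> large_faces G" "v = nabla F" "v \<in> verts C"
proof -
  have "v \<in> verts C" "v \<in> verts H" using assms CH unfolding K_def subgraph_of_def by auto
  with assms(2) that show thesis unfolding verts_H by blast
qed

text \<open>Every edge at a new vertex leads to \<open>G\<close>, so the two neighbours on
  \<open>C\<close> of a new vertex of \<open>K\<close> are distinct vertices of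
  \<open>G\<close>.\<close>

lemma two_connected_K: "two_connected K"
proof (rule two_connected_extend [OF G.simple two_conn])
  show "subgraph_of G K" unfolding subgraph_of_def K_def by simp
  show "finite (verts K)" using simple_K unfolding simple_graph_def by blast
  fix x assume "x \<in> verts K - verts G"
  then obtain F where F: "F \<in> large_faces G" "x = nabla F" "x \<in> verts C"
    by (auto elim: new_vertex)
  then obtain ws where ws: "cycle_list C (x # ws)" using cycle_list_at [OF C_cycle] by metis
  have "{x, hd ws} \<in> edges C" "{x, last ws} \<in> edges C" using cycle_list_neighbours(1) [OF ws] by blast+
  moreover then have "hd ws \<in> verts G" "last ws \<in> verts G"
    using nabla_edge [OF F(1)] C_edge_in boundary_sub_G unfolding F(2) by metis+
  ultimately show "\<exists>y\<in>verts G. \<exists>z\<in>verts G. y \<noteq> z \<and> {x, y} \<in> edges K \<and> {x, z} \<in> edges K"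
    using cycle_list_neighbours(3) [OF ws] unfolding K_def by auto
qed

lemma cyclic_faces_K: "H.cyclic_faces K"
  by (rule H.cyclic_faces_two_connected [OF KH simple_K two_connected_K])

lemma C_points: "points_of H C = (\<Union>e\<in>edges C. arc_of H e)"
  by (rule H.points_of_cycle [OF C_cycle CH])

lemma vertex_on_C: "v \<in> verts H \<Longrightarrow> v \<in> points_of H C \<longleftrightarrow> v \<in> verts C"
  by (rule H.vertex_on_points [OF CH C_edge_verts])

lemma points_K: "points_of H K = points_of H G \<union> points_of H C"
  unfolding points_of_def K_def by auto

lemma sides: "components (- points_of H C) = {inside (points_of H C), outside (points_of H C)}"
  "inside (points_of H C) \<noteq> outside (points_of H C)"
  "A \<in> components (- points_of H C) \<Longrightarrow> frontier A = points_of H C"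
proof -
  obtain p where p: "simple_path p" "pathfinish p = pathstart p" "path_image p = points_of H C"
    using H.cycle_loop [OF C_cycle CH] .
  show "components (- points_of H C) = {inside (points_of H C), outside (points_of H C)}"
    "inside (points_of H C) \<noteq> outside (points_of H C)"
    using Jordan_components [OF p(1,2)] unfolding p(3) .
  moreover have "frontier (inside (points_of H C)) = points_of H C"
      "frontier (outside (points_of H C)) = points_of H C"
    using Jordan_inside_outside [OF p(1,2)] unfolding p(3) by simp_all
  ultimately show "A \<in> components (- points_of H C) \<Longrightarrow> frontier A = points_of H C"
    by auto
qed

text \<open>An edge with both ends off \<open>C\<close> is not on \<open>C\<close> and could meet an
  edge of \<open>C\<close> only in a common end, so its whole arc avoids \<open>C\<close>.\<close>

lemma edge_stays_on_side:
  assumes A: "A \<in> components (- points_of H C)"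
    and e: "{u, w} \<in> edges H" and "u \<in> A" "w \<notin> verts C"
  shows "w \<in> A"
proof -
  let ?A = "arc_of H {u, w}"
  have uw: "u \<in> verts H" "w \<in> verts H" using H.edge_subset [OF e] by auto
  have "u \<notin> points_of H C" using in_components_subset [OF A] \<open>u \<in> A\<close> by blast
  then have "u \<notin> verts C" using vertex_on_C uw by blast
  have "p \<notin> points_of H C" if p: "p \<in> ?A" for p
  proof
    assume "p \<in> points_of H C"
    then obtain f where f: "f \<in> edges C" "p \<in> arc_of H f" unfolding C_points by blast
    have "f \<noteq> {u, w}" using C_edge_verts [OF f(1)] \<open>u \<notin> verts C\<close> by auto
    then have "p \<in> {u, w}" "p \<in> f" using H.arcs_meet [OF e C_edge_in [OF f(1)]] p f(2) by blast+
    then show False using C_edge_verts [OF f(1)] \<open>u \<notin> verts C\<close> \<open>w \<notin> verts C\<close> by blast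
  qed
  then have "?A \<subseteq> - points_of H C" by blast
  moreover have "connected ?A" using H.edge_arc [OF e] connected_arc_image by metis
  moreover have "u \<in> ?A" "w \<in> ?A" using H.arc_facts(1) [OF e] by auto
  ultimately show ?thesis using components_maximal [OF A, of ?A] \<open>u \<in> A\<close> by blast
qed

section \<open>How face boundaries meet \<open>C\<close>\<close>

lemma large_face_trace:
  assumes F: "F \<in> large_faces G" and n: "nabla F \<notin> verts C"
    and xy: "x \<in> verts (boundary G F) \<inter> verts C" "y \<in> verts (boundary G F) \<inter> verts C" "x \<noteq> y"
  shows "{x, y} \<in> edges (boundary G F)"
proof -
  \<comment> \<open>A covering face has its new vertex on \<open>C\<close>; with covering excluded,
    not crossing means that no nonadjacent pair lies on \<open>C\<close>.\<close>
  have "\<not> covers G nabla F C"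
    using n C_edge_verts unfolding covers_def by blast
  with uncrossed [OF F] xy show ?thesis unfolding crosses_def by blast
qed

text \<open>The case to settle is a new vertex \<open>h\<close> off \<open>C\<close>. Its large face
  has two nonadjacent boundary vertices; these cannot both lie on \<open>C\<close>, and one that
  does not is joined to \<open>h\<close> and so lies on the same side.\<close>

lemma side_contains_G_vertex:
  assumes A: "A \<in> components (- points_of H C)" and h: "h \<in> verts H" "h \<in> A"
  obtains g where "g \<in> verts G" "g \<in> A"
proof (cases "h \<in> verts G")
  case True
  with h that show thesis by blast
next
  case False
  then obtain F where F: "F \<in> large_faces G" "h = nabla F" using h(1) unfolding verts_H by blast
  have "h \<notin> verts C" using h vertex_on_C in_components_subset [OF A] by blast
  let ?B = "boundary G F"
  have B: "is_cycle ?B" "\<not> card (edges ?B) < 4" using F(1) unfolding large_faces_def by auto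
  then obtain x y where xy: "x \<in> verts ?B" "y \<in> verts ?B" "x \<noteq> y" "{x, y} \<notin> edges ?B"
    using cycle_pairwise_adjacent [OF B(1)] by blast
  then obtain v where v: "v \<in> verts ?B" "v \<notin> verts C"
    using large_face_trace [OF F(1)] \<open>h \<notin> verts C\<close> unfolding F(2) by blast
  then have "{h, v} \<in> edges H" using F unfolding edges_H by blast
  then have "v \<in> A" using edge_stays_on_side [OF A _ h(2) v(2)] by blast
  with v(1) boundary_sub_G that show thesis by blast
qed

text \<open>Otherwise chordlessness would put the edges of \<open>B\<close> on \<open>C\<close> as
  well, and the face would be the whole side \<open>A\<close>. But \<open>A\<close> contains the
  vertex \<open>g\<close> of \<open>G\<close>, and a face of \<open>K\<close> contains no vertex of
  \<open>G\<close>.\<close>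

lemma face_boundary_not_in_C:
  assumes A: "A \<in> components (- points_of H C)" "g \<in> verts G" "g \<in> A"
    and \<phi>: "\<phi> \<in> components (- points_of H K)" "\<phi> \<subseteq> A"
    and B: "is_cycle B" "subgraph_of B K" "frontier \<phi> = points_of H B"
  shows "\<not> verts B \<subseteq> verts C"
proof
  assume sub: "verts B \<subseteq> verts C"
  have BH: "subgraph_of B H" using B(2) KH unfolding subgraph_of_def by blast
  have "edges B \<subseteq> edges C"
  proof
    fix e assume e: "e \<in> edges B"
    then have "e \<in> edges H" using BH unfolding subgraph_of_def by blast
    then show "e \<in> edges C" using C_induced is_cycle_edge_subset [OF B(1) e] sub by blast
  qed
  then have fr: "frontier \<phi> \<subseteq> points_of H C"
    using B(3) H.points_of_cycle [OF B(1) BH] C_points by auto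
  note f = H.frontier_component_points_of [OF KH \<phi>(1)]
  have "\<phi> \<in> components (- points_of H C)"
    using f(3-5) fr unfolding points_K by (intro componentsI_frontier) auto
  then have "\<phi> = A" using components_nonoverlap A(1) f(5) \<phi>(2) by blast
  then have "g \<notin> points_of H K" using f(3) A(3) by blast
  then show False using A(2) unfolding points_of_def K_def by simp
qed

text \<open>The boundary of a face on one side of \<open>C\<close> meets \<open>C\<close> in a path (listed by \<open>cs\<close>) whose
  vertices in \<open>G\<close> are among its ends; what is left is a nonempty path in \<open>G\<close>.\<close>

lemma face_trace:
  assumes A: "A \<in> components (- points_of H C)" "g \<in> verts G" "g \<in> A"
    and \<phi>: "\<phi> \<in> components (- points_of H K)" "\<phi> \<subseteq> A"
  obtains B :: "complex ugraph" and cs rest where "is_cycle B" "subgraph_of B K"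
    "frontier \<phi> = points_of H B" "cycle_list B (cs @ rest)" "rest \<noteq> []"
    "set cs = verts B \<inter> verts C" "\<forall>s\<in>set cs \<inter> verts G. s = hd cs \<or> s = last cs"
proof -
  note f = H.frontier_component_points_of [OF KH \<phi>(1)]
  obtain F where F: "F \<in> components (- points_of H G)" "\<phi> \<subseteq> F"
    by (rule component_sub_Compl [OF \<phi>(1)]) (use points_K in auto)
  note F' = face_of_G [OF F(1)]
  show thesis
  proof (cases "F \<in> large_faces G \<and> nabla F \<in> verts C")
    case False
    \<comment> \<open>An edge of \<open>C\<close> can enter \<open>F\<close> only as a spoke of
      \<open>F\<close>, and this would put the new vertex of \<open>F\<close> on \<open>C\<close>.
      Hence \<open>F\<close> is itself a face of \<open>K\<close>.\<close>
    have "F \<inter> points_of H C = {}"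
    proof (rule ccontr)
      assume "\<not> ?thesis"
      then obtain p e where p: "p \<in> F" "e \<in> edges C" "p \<in> arc_of H e"
        unfolding C_points by blast
      from C_edge_in [OF p(2)] show False
      proof (cases rule: edge_cases)
        case 1
        then have "p \<in> points_of H G" using p(3) unfolding points_of_def by blast
        then show False using p(1) F'(3) by blast
      next
        case (2 F'' v)
        have "p \<noteq> v" using F'(4) [OF boundary_sub_G [OF 2(2)]] p(1) by metis
        then have "p \<in> F''"
          using spoke_in_face [OF 2(1)] C_edge_in [OF p(2)] p(3) unfolding 2(3) by blast
        then have "F'' = F"
          using components_nonoverlap [OF large_face [OF 2(1)] F(1)] p(1) by blast
        then show False using 2(1,3) C_edge_verts [OF p(2)] False by blast
      qed
    qed
    then have "F \<subseteq> - points_of H K" using F'(3) points_K by blast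
    then have "F \<subseteq> \<phi>" using components_maximal [OF \<phi>(1) F'(2)] F(2) f(5) by blast
    with F(2) have "\<phi> = F" by blast
    let ?B = "boundary G F"
    have BK: "subgraph_of ?B K" using F'(6) unfolding subgraph_of_def K_def by auto
    have ne: "verts ?B \<inter> verts C \<noteq> verts ?B"
      using face_boundary_not_in_C [OF A \<phi> F'(5) BK] F'(7) \<open>\<phi> = F\<close> by blast
    have adj: "{x, y} \<in> edges ?B"
      if "x \<in> verts ?B \<inter> verts C" "y \<in> verts ?B \<inter> verts C" "x \<noteq> y" for x y
    proof (cases "F \<in> large_faces G")
      case True
      with False large_face_trace that show ?thesis by blast
    next
      case nl: False
      have "F \<in> faces G" using F(1) unfolding faces_def points_G .
      then have "card (edges ?B) < 4" using nl F'(5) unfolding large_faces_def by auto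
      then show ?thesis using cycle_pairwise_adjacent [OF F'(5)] that by blast
    qed
    obtain cs rest where cr: "cycle_list ?B (cs @ rest)" "set cs = verts ?B \<inter> verts C"
        "rest \<noteq> []" "length cs \<le> 2"
      using clique_in_cycle [OF F'(5) Int_lower1 ne adj] by blast
    have "s = hd cs \<or> s = last cs" if s: "s \<in> set cs" for s
    proof -
      obtain a cs' where a: "cs = a # cs'" using s by (cases cs) auto
      have "cs' = [] \<or> (\<exists>b. cs' = [b])" using cr(4) a by (cases cs'; cases "tl cs'") auto
      then show ?thesis using a s by auto
    qed
    then show thesis
      using that [OF F'(5) BK _ cr(1,3,2)] F'(7) \<open>\<phi> = F\<close> by blast
  next
    case True
    then have L: "F \<in> large_faces G" and nC: "nabla F \<in> verts C" by auto
    let ?n = "nabla F"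
    have fr: "frontier \<phi> \<subseteq> closure F"
      using F(2) closure_mono [of \<phi> F] unfolding frontier_def by blast
    obtain B :: "complex ugraph" where B: "is_cycle B" "subgraph_of B K" "frontier \<phi> = points_of H B"
      using cyclic_faces_K \<phi>(1) unfolding H.cyclic_faces_def by blast
    have BH: "subgraph_of B H" using B(2) KH unfolding subgraph_of_def by blast
    have ptB: "v \<in> closure F" if "v \<in> verts B" for v
      using that fr B(3) unfolding points_of_def by blast
    \<comment> \<open>Otherwise all edges of \<open>B\<close> are in \<open>G\<close>, since a spoke
      on the frontier of \<open>\<phi>\<close> would be a spoke of \<open>F\<close>. Then
      \<open>\<phi>\<close> would be all of \<open>F\<close>, which contains its new vertex, a
      vertex of \<open>K\<close>.\<close>
    have nB: "?n \<in> verts B"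
    proof (rule ccontr)
      assume n: "?n \<notin> verts B"
      have "edges B \<subseteq> edges G"
      proof
        fix e assume e: "e \<in> edges B"
        then have "e \<in> edges H" using BH unfolding subgraph_of_def by blast
        then show "e \<in> edges G"
        proof (cases rule: edge_cases)
          case (2 F' v)
          have eB: "e \<subseteq> verts B" by (rule is_cycle_edge_subset [OF B(1) e])
          then have "nabla F' \<in> closure F" using ptB 2(3) by blast
          then have "F = F'" by (rule face_unique [OF F(1) 2(1)])
          with n eB 2(3) show ?thesis by blast
        qed
      qed
      then have "points_of H B \<subseteq> points_of H G"
        unfolding H.points_of_cycle [OF B(1) BH] unfolding points_of_def by blast
      then have "\<phi> \<in> components (- points_of H G)"
        using f(3-5) B(3) unfolding points_K by (intro componentsI_frontier) auto
      then have "\<phi> = F" using components_nonoverlap F(1) f(5) F(2) by blast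
      then have "?n \<in> \<phi>" using nabla_in [OF L] by blast
      moreover have "?n \<in> points_of H K" using nC unfolding points_of_def K_def by simp
      ultimately show False using f(3) by blast
    qed
    obtain ws where ws: "cycle_list B (?n # ws)" using cycle_list_at [OF B(1) nB] .
    obtain vs where vs: "cycle_list C (?n # vs)" using cycle_list_at [OF C_cycle nC] .
    note nbB = cycle_list_neighbours [OF ws] and nbC = cycle_list_neighbours [OF vs]
    have nG: "?n \<notin> verts G" by (rule nabla_not_G [OF L])
    \<comment> \<open>The only edges of \<open>K\<close> at a new vertex are those of
      \<open>C\<close>, so \<open>B\<close> passes through \<open>?n\<close> exactly as
      \<open>C\<close> does.\<close>
    have toC: "{?n, w} \<in> edges C" if "{?n, w} \<in> edges B" for w
    proof -
      have "{?n, w} \<in> edges K" using that B(2) unfolding subgraph_of_def by blast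
      moreover have "{?n, w} \<notin> edges G" using G.edge_subset [of "{?n, w}"] nG by auto
      ultimately show ?thesis unfolding K_def by simp
    qed
    have hl: "{?n, hd ws} \<in> edges C" "{?n, last ws} \<in> edges C"
      using toC nbB(1) by blast+
    then have eq: "{hd ws, last ws} = {hd vs, last vs}"
      using nbB(3) nbC(1) by (metis doubleton_eq_iff)
    have XC: "verts B \<inter> verts C = {?n, hd ws, last ws}"
    proof
      have "hd ws \<in> verts B" "last ws \<in> verts B"
        using ws nbB(2) unfolding cycle_list_def by auto
      moreover have "hd ws \<in> verts C" "last ws \<in> verts C"
        using hl C_edge_verts by blast+
      ultimately show "{?n, hd ws, last ws} \<subseteq> verts B \<inter> verts C" using nB nC by blast
      show "verts B \<inter> verts C \<subseteq> {?n, hd ws, last ws}"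
      proof
        fix v assume v: "v \<in> verts B \<inter> verts C"
        have vK: "v \<in> verts K" using v unfolding K_def by simp
        show "v \<in> {?n, hd ws, last ws}"
        proof (cases "v \<in> verts G")
          case True
          \<comment> \<open>A vertex of \<open>G\<close> in the closure of \<open>F\<close> is a
            boundary vertex, hence joined to \<open>?n\<close> in \<open>H\<close>. Chordlessness
            puts this edge on \<open>C\<close>, where \<open>?n\<close> has only two
            neighbours.\<close>
          have "v \<in> closure F" using ptB v by blast
          then have "v \<in> frontier F"
            using F'(1,4) True by (simp add: frontier_def interior_open)
          then have "v \<in> verts (boundary G F)" using True unfolding boundary_def by simp
          then have "{?n, v} \<in> edges H" using L unfolding edges_H by blast
          then have "{?n, v} \<in> edges C" using C_induced nC v by simp
          then have "v \<in> {hd vs, last vs}" using nbC(1) by simp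
          then show ?thesis using eq by blast
        next
          case False
          then obtain F' where F': "F' \<in> large_faces G" "v = nabla F'"
            using new_vertex [OF vK] by metis
          then have "F = F'" using face_unique [OF F(1)] ptB v by blast
          with F' show ?thesis by simp
        qed
      qed
    qed
    obtain x ws' where x: "ws = x # ws'" using nbB(2) by (cases ws) auto
    have "ws' \<noteq> []" using nbB(3) x by auto
    then obtain mid y where split: "ws = x # mid @ [y]"
      using x by (metis rev_exhaust)
    \<comment> \<open>The rotation lists the shared path first with the new vertex in the middle, so
      that its vertices in \<open>G\<close> are its ends.\<close>
    have "cycle_list B ([y] @ (?n # x # mid))"
      by (rule cycle_list_rotate) (use ws split in simp)
    then have cl: "cycle_list B ([y, ?n, x] @ mid)" by simp
    have cs: "set [y, ?n, x] = verts B \<inter> verts C" unfolding XC split by auto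
    have "mid \<noteq> []"
    proof
      assume "mid = []"
      then have "verts B = set [y, ?n, x]" using cl unfolding cycle_list_def by simp
      then have "verts B \<subseteq> verts C" using cs by blast
      then show False using face_boundary_not_in_C [OF A \<phi> B] by blast
    qed
    moreover have "s = hd [y, ?n, x] \<or> s = last [y, ?n, x]"
      if "s \<in> set [y, ?n, x]" "s \<in> verts G" for s
      using that nG by auto
    ultimately show thesis using that [OF B cl _ cs] by blast
  qed
qed

abbreviation R :: "complex set \<Rightarrow> (complex \<times> complex) set" where
  "R T \<equiv> {(a, b). {a, b} \<in> edges (delete_verts G T)}"

text \<open>The list \<open>rest\<close> gives exactly the vertices of the boundary in
  \<open>A\<close>: they are off \<open>C\<close>, and a frontier point of \<open>\<phi>\<close> off
  \<open>C\<close> lies in \<open>A\<close>. Edges of \<open>B\<close> at these vertices are not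
  edges of \<open>C\<close>, hence edges of \<open>G\<close>; this applies to the path itself and to
  the edges attaching it to the ends of \<open>cs\<close>.\<close>

lemma face_side:
  assumes A: "A \<in> components (- points_of H C)" "g \<in> verts G" "g \<in> A"
    and \<phi>: "\<phi> \<in> components (- points_of H K)" "\<phi> \<subseteq> A"
  shows "frontier \<phi> \<inter> verts G \<inter> A \<noteq> {}"
    and "\<And>u v. u \<in> frontier \<phi> \<inter> verts G \<inter> A \<Longrightarrow> v \<in> frontier \<phi> \<inter> verts G \<inter> A \<Longrightarrow> (u, v) \<in> (R S)\<^sup>*"
    and "\<And>s. s \<in> frontier \<phi> \<inter> S \<Longrightarrow> \<exists>r\<in>verts G \<inter> A. {s, r} \<in> edges G"
    and "\<exists>B::complex ugraph. is_cycle B \<and> subgraph_of B H \<and> frontier \<phi> = points_of H B"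
proof -
  obtain B :: "complex ugraph" and cs rest where B: "is_cycle B" "subgraph_of B K"
    "frontier \<phi> = points_of H B" and cl: "cycle_list B (cs @ rest)" "rest \<noteq> []"
    and cs: "set cs = verts B \<inter> verts C" "\<forall>s\<in>set cs \<inter> verts G. s = hd cs \<or> s = last cs"
    by (rule face_trace [OF A \<phi>])
  have BH: "subgraph_of B H" using B(2) KH unfolding subgraph_of_def by blast
  with B show "\<exists>B::complex ugraph. is_cycle B \<and> subgraph_of B H \<and> frontier \<phi> = points_of H B"
    by blast
  have on_B: "v \<in> frontier \<phi> \<longleftrightarrow> v \<in> verts B" if "v \<in> verts G" for v
    unfolding B(3) using H.vertex_on_points [OF BH is_cycle_edge_subset [OF B(1)]] that verts_H
    by blast
  have dist: "set cs \<inter> set rest = {}" "verts B = set cs \<union> set rest"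
    using cl unfolding cycle_list_def by auto
  have rest: "v \<in> frontier \<phi> \<inter> verts G \<inter> A" if v: "v \<in> set rest" for v
  proof -
    have vB: "v \<in> verts B" "v \<notin> verts C" using v dist cs(1) by blast+
    then have vG: "v \<in> verts G" using B(2) unfolding subgraph_of_def K_def by auto
    then have "v \<notin> points_of H C" using vertex_on_C vB(2) verts_H by blast
    moreover have "v \<in> frontier \<phi>" using on_B vG vB(1) by blast
    then have "v \<in> closure A" using closure_mono [OF \<phi>(2)] unfolding frontier_def by blast
    ultimately have "v \<in> A"
      using closure_Un_frontier [of A] sides(3) [OF A(1)] by blast
    with vG \<open>v \<in> frontier \<phi>\<close> show ?thesis by blast
  qed
  have in_rest: "v \<in> set rest" if v: "v \<in> frontier \<phi> \<inter> verts G \<inter> A" for v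
  proof -
    have "v \<notin> verts C"
      using v vertex_on_C [of v] verts_H in_components_subset [OF A(1)] by blast
    moreover have "v \<in> verts B" using on_B v by blast
    ultimately show ?thesis using dist(2) cs(1) by blast
  qed
  show "frontier \<phi> \<inter> verts G \<inter> A \<noteq> {}"
    using rest [of "hd rest"] cl(2) by auto
  have edge_G: "e \<in> edges G" if "e \<in> edges B" "v \<in> e" "v \<in> set rest" for e v
  proof -
    have "v \<notin> verts C" using that(3) dist cs(1) by blast
    then have "e \<notin> edges C" using C_edge_verts that(2) by blast
    with that(1) B(2) show ?thesis unfolding subgraph_of_def K_def by auto
  qed
  have "path_edges rest \<subseteq> edges (delete_verts G S)"
  proof
    fix e assume e: "e \<in> path_edges rest"
    then have eB: "e \<in> edges B" using cycle_list_edges(1) [OF cl] by blast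
    obtain u v where uv: "e = {u, v}" "e \<in> edges H"
      using H.edge_ends eB BH unfolding subgraph_of_def by (metis subsetD)
    have sub: "e \<subseteq> set rest" by (rule path_edges_subset [OF e])
    then have "e \<in> edges G" using edge_G [OF eB, of u] uv(1) by blast
    moreover have "e \<inter> S = {}" using sub dist cs(1) by blast
    ultimately show "e \<in> edges (delete_verts G S)" unfolding delete_verts_def by simp
  qed
  then show "(u, v) \<in> (R S)\<^sup>*"
    if "u \<in> frontier \<phi> \<inter> verts G \<inter> A" "v \<in> frontier \<phi> \<inter> verts G \<inter> A" for u v
    using path_connected_edges in_rest that by metis
  show "\<exists>r\<in>verts G \<inter> A. {s, r} \<in> edges G" if s: "s \<in> frontier \<phi> \<inter> S" for s
  proof -
    have scs: "s \<in> set cs" using s on_B cs(1) by blast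
    then have "cs \<noteq> []" by auto
    have "hd rest \<in> set rest" "last rest \<in> set rest" using cl(2) by auto
    moreover have "s = hd cs \<or> s = last cs" using cs(2) scs s by blast
    then have "{s, last rest} \<in> edges B \<or> {s, hd rest} \<in> edges B"
      using cycle_list_edges(2,3) [OF cl \<open>cs \<noteq> []\<close>] by metis
    then obtain r where "r = hd rest \<or> r = last rest" "{s, r} \<in> edges B" by metis
    ultimately have "r \<in> set rest" "{s, r} \<in> edges B" by metis+
    then have "r \<in> verts G \<inter> A" "{s, r} \<in> edges G"
      using rest [of r] edge_G [of "{s, r}" r] by simp_all
    then show ?thesis by blast
  qed
qed

section \<open>Assembling a side of \<open>C\<close> from its faces\<close>

lemma side_covered:
  assumes A: "A \<in> components (- points_of H C)"
  shows "closure A \<subseteq> (\<Union>\<phi>\<in>{\<phi> \<in> components (- points_of H K). \<phi> \<subseteq> A}. closure \<phi>)"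
proof (rule closure_minimal)
  let ?\<Phi> = "{\<phi> \<in> components (- points_of H K). \<phi> \<subseteq> A}"
  have "finite ?\<Phi>" using H.finite_components_points_of [OF KH cyclic_faces_K] by simp
  then show "closed (\<Union>\<phi>\<in>?\<Phi>. closure \<phi>)" by (intro closed_UN) auto
  show "A \<subseteq> (\<Union>\<phi>\<in>?\<Phi>. closure \<phi>)"
  proof
    fix p assume p: "p \<in> A"
    obtain \<phi> where \<phi>: "\<phi> \<in> components (- points_of H K)" "p \<in> closure \<phi>"
      using H.in_closure_face [OF KH cyclic_faces_K] .
    have "open A" using H.frontier_component_points_of(1) [OF CH A] .
    then have "A \<inter> \<phi> \<noteq> {}" using open_Int_closure_eq_empty [of A \<phi>] p \<phi>(2) by blast
    moreover have "\<phi> \<subseteq> - points_of H C" "connected \<phi>"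
      using in_components_subset [OF \<phi>(1)] points_K in_components_connected [OF \<phi>(1)] by auto
    ultimately have "\<phi> \<subseteq> A" using components_maximal [OF A] by blast
    with \<phi> show "p \<in> (\<Union>\<phi>\<in>?\<Phi>. closure \<phi>)" by blast
  qed
qed

text \<open>As \<open>C\<close> is the frontier of \<open>A\<close>, the vertex \<open>s\<close> is
  in the closure of \<open>A\<close>, hence on the boundary of a face inside \<open>A\<close>, which
  supplies the neighbour.\<close>

lemma cut_vertex_neighbour:
  assumes A: "A \<in> components (- points_of H C)" "g \<in> verts G" "g \<in> A" and s: "s \<in> S"
  obtains r where "r \<in> verts G" "r \<in> A" "{s, r} \<in> edges G"
proof -
  have sC: "s \<in> points_of H C" using s unfolding points_of_def by blast
  then have "s \<in> closure A" using sides(3) [OF A(1)] unfolding frontier_def by blast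
  then obtain \<phi> where \<phi>: "\<phi> \<in> components (- points_of H K)" "\<phi> \<subseteq> A" "s \<in> closure \<phi>"
    using side_covered [OF A(1)] by blast
  have "s \<notin> \<phi>" using sC in_components_subset [OF A(1)] \<phi>(2) by blast
  then have "s \<in> frontier \<phi>" using \<phi>(3) interior_subset unfolding frontier_def by blast
  then show thesis using face_side(3) [OF A \<phi>(1,2)] s that by blast
qed

text \<open>If some vertices of \<open>G\<close> on the side \<open>A\<close> were not reachable from \<open>u\<close>, then the closures of
  the faces with reachable vertices and those of the faces with unreachable ones would be two
  closed sets covering the connected set \<open>A\<close>; a common point in \<open>A\<close> lies on a vertex or an edge
  shared by the boundaries of a face of each kind, and so has an end off \<open>C\<close>.\<close>

lemma side_connected:
  assumes A: "A \<in> components (- points_of H C)"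
    and u: "u \<in> verts G" "u \<in> A" and v: "v \<in> verts G" "v \<in> A"
  shows "(u, v) \<in> (R S)\<^sup>*"
proof (rule ccontr)
  assume uv: "(u, v) \<notin> (R S)\<^sup>*"
  define I where "I = {w \<in> verts G \<inter> A. (u, w) \<in> (R S)\<^sup>*}"
  define J where "J = verts G \<inter> A - I"
  define \<Phi> where "\<Phi> X = {\<phi> \<in> components (- points_of H K). \<phi> \<subseteq> A \<and> frontier \<phi> \<inter> X \<noteq> {}}"
    for X
  define U where "U X = (\<Union>\<phi>\<in>\<Phi> X. closure \<phi>)" for X
  note fs = face_side [OF A u]
  have "closed (U X)" for X
    using H.finite_components_points_of [OF KH cyclic_faces_K] unfolding U_def \<Phi>_def
    by (intro closed_UN) auto
  moreover have "A \<inter> U X \<noteq> {}" if w: "w \<in> X" "w \<in> verts G \<inter> A" for w X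
  proof -
    have "w \<in> closure A" using w closure_subset by blast
    then obtain \<phi> where \<phi>: "\<phi> \<in> components (- points_of H K)" "\<phi> \<subseteq> A" "w \<in> closure \<phi>"
      using side_covered [OF A] by blast
    have "w \<in> points_of H K" using w unfolding points_of_def K_def by simp
    then have "w \<notin> \<phi>" using in_components_subset [OF \<phi>(1)] by blast
    then have "w \<in> frontier \<phi>" using \<phi>(3) interior_subset unfolding frontier_def by blast
    then have "\<phi> \<in> \<Phi> X" using \<phi> w unfolding \<Phi>_def by blast
    then show ?thesis using \<phi>(3) w unfolding U_def by blast
  qed
  moreover have "u \<in> I" "v \<in> J" using u v uv unfolding I_def J_def by simp_all
  ultimately have "closed (U I)" "closed (U J)" "A \<inter> U I \<noteq> {}" "A \<inter> U J \<noteq> {}"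
    using u v by blast+
  moreover have "A \<subseteq> U I \<union> U J"
  proof
    fix p assume "p \<in> A"
    then have "p \<in> closure A" using closure_subset by blast
    then obtain \<phi> where \<phi>: "\<phi> \<in> components (- points_of H K)" "\<phi> \<subseteq> A" "p \<in> closure \<phi>"
      using side_covered [OF A] by blast
    have "frontier \<phi> \<inter> (I \<union> J) \<noteq> {}"
      using fs(1) [OF \<phi>(1,2)] unfolding I_def J_def by blast
    then have "\<phi> \<in> \<Phi> I \<union> \<Phi> J" using \<phi> unfolding \<Phi>_def by blast
    then show "p \<in> U I \<union> U J" using \<phi>(3) unfolding U_def by blast
  qed
  ultimately have "A \<inter> U I \<inter> U J \<noteq> {}"
    using in_components_connected [OF A] unfolding connected_closed by (metis inf_assoc inf_commute)
  then obtain p \<phi> \<psi> where p: "p \<in> A" "p \<in> closure \<phi>" "p \<in> closure \<psi>" "\<phi> \<in> \<Phi> I" "\<psi> \<in> \<Phi> J"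
    unfolding U_def by blast
  have \<phi>: "\<phi> \<in> components (- points_of H K)" "\<phi> \<subseteq> A" "frontier \<phi> \<inter> I \<noteq> {}"
    and \<psi>: "\<psi> \<in> components (- points_of H K)" "\<psi> \<subseteq> A" "frontier \<psi> \<inter> J \<noteq> {}"
    using p(4,5) unfolding \<Phi>_def by blast+
  \<comment> \<open>One reachable vertex on the boundary of the face makes all those in
    \<open>A\<close> reachable, along the path left over from the boundary.\<close>
  have I: "w \<in> I" if "w \<in> frontier \<phi> \<inter> verts G \<inter> A" for w
  proof -
    obtain z where "z \<in> frontier \<phi>" "z \<in> I" using \<phi>(3) by blast
    then have "(z, w) \<in> (R S)\<^sup>*" "(u, z) \<in> (R S)\<^sup>*" using fs(2) [OF \<phi>(1,2) _ that] unfolding I_def by blast+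
    then have "(u, w) \<in> (R S)\<^sup>*" by (rule rtrancl_trans [rotated])
    with that show ?thesis unfolding I_def by blast
  qed
  have J: "w \<notin> I" if "w \<in> frontier \<psi> \<inter> verts G \<inter> A" for w
  proof
    assume "w \<in> I"
    obtain z where z: "z \<in> frontier \<psi>" "z \<in> J" using \<psi>(3) by blast
    then have "(w, z) \<in> (R S)\<^sup>*" "(u, w) \<in> (R S)\<^sup>*"
      using fs(2) [OF \<psi>(1,2) that] \<open>w \<in> I\<close> unfolding I_def J_def by blast+
    then have "(u, z) \<in> (R S)\<^sup>*" by (rule rtrancl_trans [rotated])
    with z show False unfolding I_def J_def by blast
  qed
  have "\<phi> \<noteq> \<psi>" using I J fs(1) [OF \<phi>(1,2)] by blast
  then have "\<phi> \<inter> \<psi> = {}" using components_nonoverlap \<phi>(1) \<psi>(1) by blast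
  moreover have "open \<phi>" "open \<psi>"
    using H.frontier_component_points_of(1) [OF KH] \<phi>(1) \<psi>(1) by blast+
  ultimately have "p \<notin> \<phi>" "p \<notin> \<psi>"
    using open_Int_closure_eq_empty [of \<phi> \<psi>] open_Int_closure_eq_empty [of \<psi> \<phi>] p(2,3)
    by (blast, blast)
  then have pf: "p \<in> frontier \<phi>" "p \<in> frontier \<psi>"
    using p(2,3) interior_subset unfolding frontier_def by blast+
  obtain B :: "complex ugraph" where B: "is_cycle B" "subgraph_of B H" "frontier \<phi> = points_of H B"
    using fs(4) [OF \<phi>(1,2)] by blast
  obtain D :: "complex ugraph" where D: "is_cycle D" "subgraph_of D H" "frontier \<psi> = points_of H D"
    using fs(4) [OF \<psi>(1,2)] by blast
  obtain e f where ef: "e \<in> edges B" "p \<in> arc_of H e" "f \<in> edges D" "p \<in> arc_of H f"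
    using pf unfolding B(3) D(3) H.points_of_cycle [OF B(1,2)] H.points_of_cycle [OF D(1,2)] by blast
  have efH: "e \<in> edges H" "f \<in> edges H" using ef B(2) D(2) unfolding subgraph_of_def by blast+
  have pC: "p \<notin> points_of H C" using p(1) in_components_subset [OF A] by blast
  \<comment> \<open>On a common edge, the end off \<open>C\<close> comes from chordlessness; if the
    edges differ, \<open>p\<close> is itself a common end and lies in \<open>A\<close>, hence off
    \<open>C\<close>.\<close>
  obtain w where w: "w \<in> e" "w \<in> f" "w \<notin> verts C"
  proof (cases "e = f")
    case True
    have "e \<notin> edges C" using pC ef(2) unfolding points_of_def by blast
    then have "\<not> e \<subseteq> verts C" using C_induced efH(1) by blast
    with True that show thesis by blast
  next
    case False
    then have "p \<in> e" "p \<in> f" using H.arcs_meet [OF efH] ef by blast+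
    moreover have "p \<notin> verts C" using pC unfolding points_of_def by blast
    ultimately show thesis using that by blast
  qed
  have wB: "w \<in> verts B" "w \<in> verts D"
    using is_cycle_edge_subset [OF B(1) ef(1)] is_cycle_edge_subset [OF D(1) ef(3)] w by blast+
  then have wf: "w \<in> frontier \<phi>" "w \<in> frontier \<psi>"
    unfolding B(3) D(3) points_of_def by blast+
  have wH: "w \<in> verts H" using H.edge_subset efH(1) w(1) by blast
  \<comment> \<open>It has to be excluded that \<open>w\<close> is a new vertex; this holds because
    every new vertex of \<open>K\<close> is on \<open>C\<close>.\<close>
  have "w \<in> points_of H K"
    using wf(1) H.frontier_component_points_of(2) [OF KH \<phi>(1)] by blast
  moreover have "e \<subseteq> verts K" if "e \<in> edges K" for e
    by (rule simple_edge_subset [OF simple_K that])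
  ultimately have "w \<in> verts K"
    using H.vertex_on_points [OF KH _ wH] by blast
  then have "w \<in> verts G" using w(3) unfolding K_def by simp
  moreover have "w \<in> A"
  proof -
    have "w \<in> closure A" using wf(1) closure_mono [OF \<phi>(2)] unfolding frontier_def by blast
    moreover have "w \<notin> points_of H C" using vertex_on_C wH w(3) by blast
    ultimately show ?thesis
      using closure_Un_frontier [of A] sides(3) [OF A] by blast
  qed
  ultimately show False using I [of w] J [of w] wf by blast
qed

text \<open>A path of \<open>G\<close> that avoids \<open>S\<close> cannot change sides, which
  separates \<open>g\<close> from \<open>g'\<close>. If some \<open>s\<close> in \<open>S\<close> is
  kept, it has a neighbour on each side; the sides are connected in themselves, and every other kept
  vertex of \<open>S\<close> also has a neighbour on a side, so all remaining vertices reach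
  \<open>s\<close>.\<close>

lemma minimal_cut_vertices:
  assumes "Jordan_separating H C"
  shows "minimal_cut G S"
proof -
  let ?In = "inside (points_of H C)" and ?Out = "outside (points_of H C)"
  have comp: "?In \<in> components (- points_of H C)" "?Out \<in> components (- points_of H C)"
    using sides(1) by simp_all
  obtain h h' where "h \<in> verts H" "h \<in> ?In" "h' \<in> verts H" "h' \<in> ?Out"
    using assms unfolding Jordan_separating_def Int_graph_def Ext_graph_def by auto
  then obtain g g' where g: "g \<in> verts G" "g \<in> ?In" and g': "g' \<in> verts G" "g' \<in> ?Out"
    using side_contains_G_vertex [OF comp(1)] side_contains_G_vertex [OF comp(2)] by metis
  have "(g, w) \<in> (R S)\<^sup>* \<Longrightarrow> w \<in> ?In" for w
  proof (induction rule: rtrancl_induct)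
    case base
    show ?case by (rule g(2))
  next
    case (step y z)
    then have yz: "{y, z} \<in> edges G" "{y, z} \<inter> S = {}" by (simp_all add: delete_verts_def)
    then have "z \<notin> verts C" "{y, z} \<in> edges H" using G.edge_subset [OF yz(1)] edges_H by auto
    with step edge_stays_on_side [OF comp(1)] show ?case by blast
  qed
  moreover have "g' \<notin> ?In" using g'(2) inside_Int_outside by blast
  ultimately have sep: "(g, g') \<notin> (R S)\<^sup>*" by blast
  have off: "x \<notin> verts C" if "x \<in> verts G" "x \<in> ?In \<union> ?Out" for x
    using that vertex_on_C [of x] verts_H in_components_subset [OF comp(1)]
      in_components_subset [OF comp(2)] by blast
  have "g \<in> verts (delete_verts G S)" "g' \<in> verts (delete_verts G S)"
    using g g' off [of g] off [of g'] by (simp_all add: delete_verts_def del: inside_Un_outside)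
  with sep have "is_cut G S"
    unfolding is_cut_def connected_graph_def by blast
  moreover have "connected_graph (delete_verts G T)" if T: "T \<subset> S" for T
  proof -
    obtain s where s: "s \<in> S" "s \<notin> T" using T by blast
    have mono: "(R S)\<^sup>* \<subseteq> (R T)\<^sup>*"
      using T by (intro rtrancl_mono) (auto simp: delete_verts_def)
    have edge_to_side: "\<exists>r\<in>verts G \<inter> A. (t, r) \<in> (R T)\<^sup>*"
      if A: "A = ?In \<or> A = ?Out" and t: "t \<in> S" "t \<notin> T" for A t
    proof -
      have A': "A \<in> components (- points_of H C)" using A comp by blast
      obtain a where "a \<in> verts G" "a \<in> A" using A g g' by blast
      then obtain r where r: "r \<in> verts G" "r \<in> A" "{t, r} \<in> edges G"
        using cut_vertex_neighbour [OF A' _ _ t(1)] by blast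
      then have "r \<notin> T" using off A T by blast
      then have "(t, r) \<in> R T" using r(3) t(2) by (simp add: delete_verts_def)
      with r show ?thesis by blast
    qed
    have side_to_s: "(x, s) \<in> (R T)\<^sup>*"
      if A: "A = ?In \<or> A = ?Out" and x: "x \<in> verts G" "x \<in> A" for A x
    proof -
      have A': "A \<in> components (- points_of H C)" using A comp by blast
      obtain r where r: "r \<in> verts G" "r \<in> A" "(s, r) \<in> (R T)\<^sup>*"
        using edge_to_side [OF A s] by blast
      have "(x, r) \<in> (R T)\<^sup>*" using side_connected [OF A' x r(1,2)] mono by blast
      then show ?thesis using rtrancl_edges_sym [OF r(3)] by (rule rtrancl_trans)
    qed
    have to_s: "(x, s) \<in> (R T)\<^sup>*" if x: "x \<in> verts G" "x \<notin> T" for x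
    proof (cases "x \<in> verts C")
      case True
      then obtain r where r: "r \<in> verts G" "r \<in> ?In" "(x, r) \<in> (R T)\<^sup>*"
        using edge_to_side [of ?In x] x by blast
      have "(r, s) \<in> (R T)\<^sup>*" using side_to_s [of ?In r] r by blast
      with r(3) show ?thesis by (rule rtrancl_trans)
    next
      case False
      then have "x \<in> ?In \<union> ?Out"
        using vertex_on_C [of x] x(1) verts_H Union_components [of "- points_of H C"]
        unfolding sides(1) by auto
      then show ?thesis using side_to_s x(1) by blast
    qed
    show ?thesis
      unfolding connected_graph_def
    proof (intro ballI)
      fix x y assume "x \<in> verts (delete_verts G T)" "y \<in> verts (delete_verts G T)"
      then have xy: "(x, s) \<in> (R T)\<^sup>*" "(y, s) \<in> (R T)\<^sup>*"
        using to_s by (simp_all add: delete_verts_def)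
      show "(x, y) \<in> (R T)\<^sup>*"
        using xy(1) rtrancl_edges_sym [OF xy(2)] by (rule rtrancl_trans)
    qed
  qed
  ultimately show ?thesis unfolding minimal_cut_def by blast
qed

end

theorem theorem15:
  fixes G H :: plane_drawing
    and nabla :: "complex set \<Rightarrow> complex"
    and C :: "complex ugraph"
  assumes "plane_graph G" and "two_connected G"
    and "auxiliary_graph G nabla H"
    and "cycle_of C H" and "chordless C H" and "Jordan_separating H C"
    and "\<And>F. F \<in> large_faces G \<Longrightarrow> \<not> crosses G nabla F C"
  shows "minimal_cut G (verts C \<inter> verts G)"
proof -
  interpret uncrossed_cycle G H nabla C
    by unfold_locales (fact assms)+
  show ?thesis by (rule minimal_cut_vertices [OF assms(6)])
qed

end
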